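(* Let $m$ be the Bernoulli product on $[0,1)$ with parameter $0<p<1$, $p\neq 1/2$. Put $$d=-p\log_2 p-(1-p)\log_2(1-p),\qquad \sigma^2=p(1-p)\left(\log_2\frac{p}{1-p}\right)^2\quad(\sigma>0),$$ and $\Theta(t)=2^{\sqrt{2\log_2(1/t)\,\ln\ln\log_2(1/t)}}$ for $t>0$ small. Then for all $\varepsilon>0$: (1) $m\ll\widehat{\mathcal P}^{\Psi}$, where $\Psi(t)=t^d\,\Theta(t)^{-(\sigma-\varepsilon)}$; (2) $m\perp\widehat{\mathcal P}^{\Psi}$, where $\Psi(t)=t^d\,\Theta(t)^{-(\sigma+\varepsilon)}$. In particular, $\mathrm{Dim}_*(m)=\mathrm{Dim}^*(m)=d$ and $m\ll\widehat{\mathcal P}^d$. More precisely, for every Borel set $E$, $\widehat{\mathcal P}^d(E)<+\infty$ implies $m(E)=0$.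
   Context: Bernoulli product: the Borel probability measure $m$ on $[0,1)$ such that for all $n\ge1$ and $\varepsilon_1,\dots,\varepsilon_n\in\{0,1\}$, the dyadic interval $I_{\varepsilon_1\cdots\varepsilon_n}=\left[\sum_{i=1}^n\varepsilon_i2^{-i},\ \sum_{i=1}^n\varepsilon_i2^{-i}+2^{-n}\right)$ satisfies $m(I_{\varepsilon_1\cdots\varepsilon_n})=p^{s_n}(1-p)^{n-s_n}$ with $s_n=\varepsilon_1+\cdots+\varepsilon_n$. Generalized packing measure: for a positive function $\Psi$ defined for small $t>0$, the packing pre-measure is $\mathcal P^\Psi(E)=\lim_{\eta\to0}\sup\{\sum_i\Psi(|B_i|)\}$, the supremum being over countable families of pairwise disjoint balls $B_i$ centered in $E$ with $0<|B_i|\le\eta$ ($|B|$ the diameter), and the packing measure is $\widehat{\mathcal P}^\Psi(E)=\inf\{\sum_i\mathcal P^\Psi(E_i):E\subset\bigcup_iE_i\}$ (countable covers). $\widehat{\mathcal P}^s$ denotes $\widehat{\mathcal P}^\Psi$ with $\Psi(t)=t^s$. $m\ll\widehat{\mathcal P}^\Psi$ means: $\widehat{\mathcal P}^\Psi(E)=0$ implies $m(E)=0$ for every Borel set $E$. $m\perp\widehat{\mathcal P}^\Psi$ means: there is a Borel set $E$ with $m(E)=1$ and $\widehat{\mathcal P}^\Psi(E)=0$. $\mathrm{Dim}_*(m)=\inf\{\mathrm{Dim}(E): m(E)>0\}$ and $\mathrm{Dim}^*(m)=\inf\{\mathrm{Dim}(E): m(E)=1\}$, where $E$ ranges over Borel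 sets and $\mathrm{Dim}$ is packing dimension. *)

theory Defs
  imports "HOL-Probability.Probability"
begin

definition dyadic_interval :: "nat \<Rightarrow> (nat \<Rightarrow> nat) \<Rightarrow> real set" where
  "dyadic_interval n e =
     {(\<Sum>i=1..n. real (e i) / 2 ^ i) ..< (\<Sum>i=1..n. real (e i) / 2 ^ i) + 1 / 2 ^ n}"

definition bernoulli_product :: "real \<Rightarrow> real measure \<Rightarrow> bool" where
  "bernoulli_product p m \<longleftrightarrow>
     prob_space m \<and> space m = {0..<1} \<and> sets m = sets (restrict_space borel {0..<1}) \<and>
     (\<forall>n\<ge>1. \<forall>e. (\<forall>i\<in>{1..n}. e i \<in> {0, 1}) \<longrightarrow>
        measure m (dyadic_interval n e) =
          p ^ (\<Sum>i=1..n. e i) * (1 - p) ^ (n - (\<Sum>i=1..n. e i)))"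

text \<open>Balls are closed, and in the real case they are balls of the whole line, even when they are
  centred in a subset of \<open>[0,1)\<close>. Closed balls of radius \<open>0\<close> and of negative radius have diameter
  \<open>0\<close>, so they are excluded. The members of a packing are nonempty, so indexed families of pairwise
  disjoint balls correspond to disjoint sets of balls.\<close>

definition packings :: "real \<Rightarrow> 'a::metric_space set \<Rightarrow> 'a set set set" where
  "packings \<eta> E = {\<B>. countable \<B> \<and> disjoint \<B> \<and>
     (\<forall>B\<in>\<B>. (\<exists>x\<in>E. \<exists>r. B = cball x r) \<and> 0 < diameter B \<and> diameter B \<le> \<eta>)}"

definition packing_sup :: "(real \<Rightarrow> real) \<Rightarrow> real \<Rightarrow> 'a::metric_space set \<Rightarrow> ennreal" where
  "packing_sup \<Psi> \<eta> E = (SUP \<B>\<in>packings \<eta> E. \<Sum>\<^sub>\<infinity>B\<in>\<B>. ennreal (\<Psi> (diameter B)))"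

text \<open>Only the values of \<open>\<Psi>\<close> at small positive arguments matter.\<close>

definition packing_premeasure :: "(real \<Rightarrow> real) \<Rightarrow> 'a::metric_space set \<Rightarrow> ennreal" where
  "packing_premeasure \<Psi> E = Lim (at_right 0) (\<lambda>\<eta>. packing_sup \<Psi> \<eta> E)"

definition packing_measure :: "(real \<Rightarrow> real) \<Rightarrow> 'a::metric_space set \<Rightarrow> ennreal" where
  "packing_measure \<Psi> E =
     (INF F\<in>{F :: nat \<Rightarrow> 'a set. E \<subseteq> (\<Union>i. F i)}. \<Sum>i. packing_premeasure \<Psi> (F i))"

lemma packing_sup_mono:
  assumes "\<eta> \<le> \<eta>'"
  shows "packing_sup \<Psi> \<eta> E \<le> packing_sup \<Psi> \<eta>' E"
  unfolding packing_sup_def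
  by (rule SUP_subset_mono) (use assms in \<open>fastforce simp: packings_def\<close>, simp)

lemma tendsto_packing_premeasure:
  "((\<lambda>\<eta>. packing_sup \<Psi> \<eta> E) \<longlongrightarrow> packing_premeasure \<Psi> E) (at_right 0)"
  and packing_premeasure_eq_INF:
  "packing_premeasure \<Psi> E = (INF \<eta>\<in>{0<..}. packing_sup \<Psi> \<eta> E)"
proof -
  let ?I = "INF \<eta>\<in>{0<..}. packing_sup \<Psi> \<eta> E"
  have lim: "((\<lambda>\<eta>. packing_sup \<Psi> \<eta> E) \<longlongrightarrow> ?I) (at_right 0)"
  proof (rule order_tendstoI)
    fix a assume "a < ?I"
    then have "\<forall>\<eta>>0. a < packing_sup \<Psi> \<eta> E"
      by (meson INF_lower greaterThan_iff less_le_trans)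
    then show "\<forall>\<^sub>F \<eta> in at_right 0. a < packing_sup \<Psi> \<eta> E"
      by (auto simp: eventually_at_filter)
  next
    fix a assume "?I < a"
    then obtain \<delta> where \<delta>: "0 < \<delta>" "packing_sup \<Psi> \<delta> E < a"
      by (auto simp: INF_less_iff)
    have "\<forall>\<^sub>F \<eta> in at_right 0. \<eta> < \<delta>"
      using \<delta>(1) by (auto simp: eventually_at_right_field)
    then show "\<forall>\<^sub>F \<eta> in at_right 0. packing_sup \<Psi> \<eta> E < a"
      by eventually_elim (meson \<delta>(2) le_less_trans less_imp_le packing_sup_mono)
  qed
  then have eq: "packing_premeasure \<Psi> E = ?I"
    unfolding packing_premeasure_def by (intro tendsto_Lim) auto
  show "packing_premeasure \<Psi> E = ?I"
    by (rule eq)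
  show "((\<lambda>\<eta>. packing_sup \<Psi> \<eta> E) \<longlongrightarrow> packing_premeasure \<Psi> E) (at_right 0)"
    using lim by (simp add: eq)
qed

definition packing_dim :: "'a::metric_space set \<Rightarrow> ereal" where
  "packing_dim E = Inf {ereal s | s. 0 \<le> s \<and> packing_measure (\<lambda>t. t powr s) E = 0}"

definition lower_packing_dim :: "'a::metric_space measure \<Rightarrow> ereal" where
  "lower_packing_dim m = Inf {packing_dim E | E. E \<in> sets m \<and> emeasure m E > 0}"

definition upper_packing_dim :: "'a::metric_space measure \<Rightarrow> ereal" where
  "upper_packing_dim m = Inf {packing_dim E | E. E \<in> sets m \<and> emeasure m E = 1}"

text \<open>Packing measures are set functions on all subsets rather than values of the type of measures,
  hence absolute continuity and singularity with respect to a set function.\<close>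

definition abs_continuous_wrt :: "'a measure \<Rightarrow> ('a set \<Rightarrow> ennreal) \<Rightarrow> bool" where
  "abs_continuous_wrt m \<nu> \<longleftrightarrow> (\<forall>E\<in>sets m. \<nu> E = 0 \<longrightarrow> emeasure m E = 0)"

definition singular_wrt :: "'a measure \<Rightarrow> ('a set \<Rightarrow> ennreal) \<Rightarrow> bool" where
  "singular_wrt m \<nu> \<longleftrightarrow> (\<exists>E\<in>sets m. emeasure m E = 1 \<and> \<nu> E = 0)"

text \<open>The iterated logarithm and the square root are meaningful only for small \<open>t > 0\<close>.\<close>

definition Theta :: "real \<Rightarrow> real" where
  "Theta t = 2 powr sqrt (2 * log 2 (1 / t) * ln (ln (log 2 (1 / t))))"

end

theory Submission
  imports Defs "HOL-Real_Asymp.Real_Asymp"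
begin

text \<open>Two facts carry the proof: the law of the iterated logarithm for the binary digits, and
comparisons of packing measures with the local size of \<open>m\<close>.

Under \<open>m\<close> the binary digits of a point are independent and equal \<open>1\<close> with probability \<open>p\<close>. If \<open>k\<close> of
the first \<open>n\<close> digits of \<open>x\<close> equal \<open>1\<close>, the dyadic interval of order \<open>n\<close> around \<open>x\<close> (its cell) has
measure \<open>p ^ k * (1 - p) ^ (n - k)\<close>, whose binary logarithm is \<open>- n d + (k - n p) log 2 (p / (1 - p))\<close>
(\<open>measure_cell\<close>). The second term is a centred random walk with step variance \<open>\<sigma>\<^sup>2\<close>, so by the law
of the iterated logarithm its lower envelope is \<open>- \<sigma>\<close> times \<open>sqrt (2 n ln (ln n))\<close>. The function
\<open>t powr d * Theta t powr (- \<tau>)\<close> at \<open>t = 2 powr (- n)\<close> is exactly \<open>2\<close> to the power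
\<open>- n d - \<tau> sqrt (2 n ln (ln n))\<close>. Hence almost surely the measure of a cell falls below this value
for infinitely many \<open>n\<close> if \<open>\<tau> < \<sigma>\<close> (\<open>AE_measure_cell_le\<close>), and exceeds it for all large \<open>n\<close> if
\<open>\<tau> > \<sigma>\<close> (\<open>AE_measure_cell_ge\<close>).

The comparison with packings goes both ways. If balls around the points of a set eventually have
measure much larger than the gauge of their diameter, disjointness bounds every packing by a small
multiple of the total mass, and the packing measure vanishes (\<open>packing_premeasure_eq_0\<close>). If around
every point there are arbitrarily small cells of measure much smaller than the gauge, the maximal
ones among these cells are disjoint, a ball inside each gives a packing, and the set is covered by a
set whose measure is small compared with the packing (\<open>cover_by_cells\<close>); so a set of
finite packing measure is null (\<open>finite_packing_measure_imp_null\<close>). The second argument needs balls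
that are centred at given points and contained in their cells. They exist because runs of equal
digits after position \<open>n\<close> are almost surely of length \<open>O(ln n)\<close> (\<open>AE_cball_subset_cell\<close>), and the
resulting loss of a factor polynomial in \<open>n\<close> is negligible against \<open>2 powr (e * sqrt n)\<close> for every \<open>e > 0\<close>.

Everything about \<open>t powr d\<close> is the case \<open>\<tau> = 0 < \<sigma>\<close>, and the two dimensions follow by comparing
\<open>t powr s\<close> with these gauges as \<open>t\<close> tends to \<open>0\<close>.\<close>

section \<open>Deviations of finite coin sequences\<close>

abbreviation coin_words :: "nat \<Rightarrow> real \<Rightarrow> bool list pmf" where
  "coin_words n p \<equiv> replicate_pmf n (bernoulli_pmf p)"

abbreviation ones :: "bool list \<Rightarrow> nat" where
  "ones w \<equiv> count_list w True"

lemma length_filter_id: "length (filter id w) = ones w"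
  by (induction w) auto

lemma prob_bind_bernoulli:
  assumes "0 \<le> p" "p \<le> 1"
  shows "measure_pmf.prob (bind_pmf (bernoulli_pmf p) f) A =
    p * measure_pmf.prob (f True) A + (1 - p) * measure_pmf.prob (f False) A"
proof -
  have "emeasure (bind_pmf (bernoulli_pmf p) f) A =
    ennreal p * emeasure (f True) A + ennreal (1 - p) * emeasure (f False) A"
    using assms by (simp add: mult.commute)
  also have "\<dots> = ennreal (p * measure_pmf.prob (f True) A + (1 - p) * measure_pmf.prob (f False) A)"
    using assms by (simp add: measure_pmf.emeasure_eq_measure ennreal_mult'' ennreal_plus)
  finally show ?thesis
    using assms by (simp add: measure_pmf.emeasure_eq_measure del: ennreal_plus)
qed

text \<open>Chernoff's bound for the running maximum of the centred number of ones, with the factor one would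
get for the last partial sum alone. Conditioning on the first letter shifts the level \<open>a\<close> by the
first step, and averaging the bounds for the remaining letters reproduces one more factor \<open>\<phi>\<close>,
so induction replaces Doob's inequality for the exponential martingale.\<close>

lemma prob_max_excess_coin_words:
  fixes p l a :: real
  assumes p: "0 \<le> p" "p \<le> 1" and "l \<ge> 0"
  defines "\<phi> \<equiv> p * exp (l * (1 - p)) + (1 - p) * exp (- l * p)"
  shows "measure_pmf.prob (coin_words n p) {w. \<exists>j\<le>n. a \<le> ones (take j w) - j * p} \<le>
    exp (- l * a) * \<phi> ^ n"
proof (induction n arbitrary: a)
  case 0
  show ?case
    using \<open>l \<ge> 0\<close> by (cases "a \<le> 0") (auto simp: indicator_def mult_nonneg_nonpos)
next
  case (Suc n)
  have "p * (1 + l * (1 - p)) + (1 - p) * (1 + (- l * p)) \<le> \<phi>"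
    unfolding \<phi>_def using p by (intro add_mono mult_left_mono exp_ge_add_one_self) auto
  then have \<phi>: "1 \<le> \<phi>"
    by (simp add: algebra_simps)
  show ?case
  proof (cases "a \<le> 0")
    case True
    have "1 \<le> exp (- l * a) * \<phi> ^ Suc n"
      using True \<phi> \<open>l \<ge> 0\<close>
      by (metis mult_1 mult_mono exp_ge_zero one_le_exp_iff one_le_power minus_mult_minus
          mult_nonneg_nonneg neg_0_le_iff_le zero_le_one minus_mult_commute)
    with measure_pmf.prob_le_1 show ?thesis
      by (rule order_trans)
  next
    case False
    define A where "A = {w. \<exists>j\<le>Suc n. a \<le> ones (take j w) - j * p}"
    have eq: "measure_pmf.prob (coin_words n p \<bind> (\<lambda>xs. return_pmf (x # xs))) A =
      measure_pmf.prob (coin_words n p) {w. \<exists>j\<le>n. a - (of_bool x - p) \<le> ones (take j w) - j * p}" for x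
    proof -
      have "x # w \<in> A \<longleftrightarrow> (\<exists>j\<le>n. a - (of_bool x - p) \<le> ones (take j w) - j * p)" for w
        unfolding A_def mem_Collect_eq
      proof (intro iffI; elim exE conjE)
        fix j assume j: "j \<le> Suc n" "a \<le> ones (take j (x # w)) - j * p"
        with False obtain i where "j = Suc i"
          by (cases j) auto
        with j show "\<exists>j\<le>n. a - (of_bool x - p) \<le> ones (take j w) - j * p"
          by (intro exI[of _ i]) (auto simp: algebra_simps split: if_splits)
      next
        fix j assume "j \<le> n" "a - (of_bool x - p) \<le> ones (take j w) - j * p"
        then show "\<exists>j\<le>Suc n. a \<le> ones (take j (x # w)) - j * p"
          by (intro exI[of _ "Suc j"]) (auto simp: algebra_simps)
      qed
      then show ?thesis
        by (simp add: map_pmf_def[symmetric] vimage_def)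
    qed
    have "measure_pmf.prob (coin_words (Suc n) p) A \<le>
      p * (exp (- l * (a - (1 - p))) * \<phi> ^ n) + (1 - p) * (exp (- l * (a + p)) * \<phi> ^ n)"
      using Suc[of "a - (1 - p)"] Suc[of "a + p"] p
      by (simp add: prob_bind_bernoulli eq add_mono mult_left_mono)
    also have "\<dots> = (p * exp (l * (1 - p)) + (1 - p) * exp (- l * p)) * (exp (- l * a) * \<phi> ^ n)"
    proof -
      have "exp (- l * (a - (1 - p))) = exp (l * (1 - p)) * exp (- l * a)"
        "exp (- l * (a + p)) = exp (- l * p) * exp (- l * a)"
        by (simp_all add: algebra_simps flip: exp_add)
      then show ?thesis
        by (simp add: algebra_simps)
    qed
    also have "\<dots> = exp (- l * a) * \<phi> ^ Suc n"
      by (simp add: \<phi>_def)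
    finally show ?thesis
      by (simp add: A_def)
  qed
qed


text \<open>The second-order expansion of the moment generating function has the variance \<open>p (1 - p)\<close> as its
coefficient; a factor \<open>c > 1\<close> absorbs the higher-order terms. This sharp constant is what makes the
law of the iterated logarithm come out with \<open>\<sigma>\<close>.\<close>

lemma mgf_coin_bound:
  fixes p c :: real
  assumes "0 < p" "p < 1" "c > 1"
  shows "\<forall>\<^sub>F l in at_right 0. p * exp (l * (1 - p)) + (1 - p) * exp (- l * p) \<le>
    exp (c * (p * (1 - p)) * l\<^sup>2 / 2)"
proof -
  have "((\<lambda>l. (p * exp (l * (1 - p)) + (1 - p) * exp (- l * p) - 1) / l\<^sup>2) \<longlongrightarrow> p * (1 - p) / 2) (at_right 0)"
    using assms by (real_asymp, simp add: field_simps)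
  moreover have "p * (1 - p) / 2 < c * (p * (1 - p)) / 2"
    using assms mult_strict_right_mono[of 1 c "p * (1 - p)"] by simp
  ultimately have "\<forall>\<^sub>F l in at_right 0.
    (p * exp (l * (1 - p)) + (1 - p) * exp (- l * p) - 1) / l\<^sup>2 < c * (p * (1 - p)) / 2"
    by (rule order_tendstoD)
  then show ?thesis
    using eventually_at_right_less
  proof eventually_elim
    case (elim l)
    then have "p * exp (l * (1 - p)) + (1 - p) * exp (- l * p) \<le> 1 + c * (p * (1 - p)) * l\<^sup>2 / 2"
      by (simp add: divide_simps)
    also have "\<dots> \<le> exp (c * (p * (1 - p)) * l\<^sup>2 / 2)"
      by (rule exp_ge_add_one_self)
    finally show ?case .
  qed
qed

lemma prob_pmf_change_of_measure:
  assumes "finite S" "\<And>k. k \<in> S \<Longrightarrow> R * pmf Q k \<le> pmf P k"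
  shows "R * measure_pmf.prob Q S \<le> measure_pmf.prob P S"
  using assms by (simp add: measure_measure_pmf_finite sum_distrib_left sum_mono)

text \<open>The likelihood ratio of the two binomial distributions, written around the mean \<open>n q\<close> of the second:
\<open>n\<close> times the relative entropy, plus the deviation from that mean times the difference of log odds.\<close>

lemma pmf_binomial_tilt:
  fixes p q :: real
  assumes p: "0 < p" "p < 1" and q: "0 < q" "q < 1" and "k \<le> n"
  shows "pmf (binomial_pmf n p) k = pmf (binomial_pmf n q) k *
    exp (- (n * (q * ln (q / p) + (1 - q) * ln ((1 - q) / (1 - p))))
         - (k - n * q) * (ln (q / p) - ln ((1 - q) / (1 - p))))"
proof -
  have "exp (- (n * (q * ln (q / p) + (1 - q) * ln ((1 - q) / (1 - p))))
         - (k - n * q) * (ln (q / p) - ln ((1 - q) / (1 - p)))) =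
    exp (- (k * ln (q / p)) - (n - k) * ln ((1 - q) / (1 - p)))"
    using \<open>k \<le> n\<close> by (simp add: algebra_simps)
  also have "\<dots> = inverse ((q / p) ^ k) * inverse (((1 - q) / (1 - p)) ^ (n - k))"
    using p q by (simp add: exp_diff exp_minus exp_of_nat_mult divide_inverse)
  finally show ?thesis
    using p q by (simp add: power_divide)
qed

lemma relative_entropy_tendsto:
  fixes p r :: real
  assumes "0 < p" "0 < r"
  shows "((\<lambda>y. ((p + y) * ln ((p + y) / p) + (r - y) * ln ((r - y) / r)) / y\<^sup>2)
      \<longlongrightarrow> 1 / (2 * p) + 1 / (2 * r)) (at_right 0)"
  using assms by (real_asymp, simp add: field_simps)

lemma log_odds_tendsto:
  fixes p r :: real
  assumes "0 < p" "0 < r"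
  shows "((\<lambda>y. (ln ((p + y) / p) - ln ((r - y) / r)) / y) \<longlongrightarrow> 1 / p + 1 / r) (at_right 0)"
  using assms by (real_asymp, simp add: field_simps)

text \<open>For a tilt from \<open>p\<close> to \<open>p + y\<close> the relative entropy is asymptotic to \<open>y\<^sup>2 / (2 p (1 - p))\<close> and the
change of log odds to \<open>y / (p (1 - p))\<close>. Only the constant of the entropy must be sharp.\<close>

lemma tilt_cost_asymptotics:
  fixes p c :: real
  assumes "0 < p" "p < 1" "c > 1"
  shows "\<forall>\<^sub>F y in at_right 0. p + y < 1 \<and>
    (p + y) * ln ((p + y) / p) + (1 - (p + y)) * ln ((1 - (p + y)) / (1 - p)) \<le> c * y\<^sup>2 / (2 * (p * (1 - p))) \<and>
    ln ((p + y) / p) - ln ((1 - (p + y)) / (1 - p)) \<le> 2 * y / (p * (1 - p))"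
proof -
  have v: "p * (1 - p) > 0"
    using assms by simp
  have "((\<lambda>y. p + y) \<longlongrightarrow> p + 0) (at_right 0)"
    by (intro tendsto_intros)
  then have 1: "\<forall>\<^sub>F y in at_right 0. p + y < 1"
    using assms by (intro order_tendstoD) auto
  have "((\<lambda>y. ((p + y) * ln ((p + y) / p) + (1 - p - y) * ln ((1 - p - y) / (1 - p))) / y\<^sup>2)
      \<longlongrightarrow> 1 / (2 * p) + 1 / (2 * (1 - p))) (at_right 0)"
    using assms by (intro relative_entropy_tendsto) auto
  moreover have "1 / (2 * p) + 1 / (2 * (1 - p)) = 1 / (2 * (p * (1 - p)))"
    using assms by (simp add: divide_simps)
  then have "1 / (2 * p) + 1 / (2 * (1 - p)) < c / (2 * (p * (1 - p)))"
    using assms v divide_strict_right_mono[of 1 c "2 * (p * (1 - p))"] by simp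
  ultimately have 2: "\<forall>\<^sub>F y in at_right 0.
    ((p + y) * ln ((p + y) / p) + (1 - p - y) * ln ((1 - p - y) / (1 - p))) / y\<^sup>2 < c / (2 * (p * (1 - p)))"
    by (rule order_tendstoD)
  have "((\<lambda>y. (ln ((p + y) / p) - ln ((1 - p - y) / (1 - p))) / y) \<longlongrightarrow> 1 / p + 1 / (1 - p)) (at_right 0)"
    using assms by (intro log_odds_tendsto) auto
  moreover have "1 / p + 1 / (1 - p) = 1 / (p * (1 - p))"
    using assms by (simp add: divide_simps)
  then have "1 / p + 1 / (1 - p) < 2 / (p * (1 - p))"
    using v divide_strict_right_mono[of 1 2 "p * (1 - p)"] by simp
  ultimately have 3: "\<forall>\<^sub>F y in at_right 0.
    (ln ((p + y) / p) - ln ((1 - p - y) / (1 - p))) / y < 2 / (p * (1 - p))"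
    by (rule order_tendstoD)
  show ?thesis
    using 1 2 3 eventually_at_right_less
  proof eventually_elim
    case (elim y)
    then show ?case
      using v by (simp add: pos_divide_less_eq less_imp_le diff_diff_eq)
  qed
qed

text \<open>A lower bound matching the Gaussian tail, for deviations \<open>a\<close> between the orders \<open>sqrt n\<close> and \<open>n\<close>.
Under the tilted parameter \<open>q\<close> with \<open>n q = n p + a + sqrt n\<close> the deviation is typical: Hoeffding's
inequality gives probability at least \<open>1/2\<close> for distance less than \<open>sqrt n\<close> from \<open>n q\<close>. On that event
the likelihood ratio costs the relative entropy, which yields \<open>a\<^sup>2 / (2 p (1 - p) n)\<close> up to the factor
\<open>c\<close>, and a term of order \<open>a / sqrt n\<close>, which is small against \<open>a\<^sup>2 / n\<close> because \<open>a \<ge> A * sqrt n\<close>.\<close>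

lemma binomial_moderate_deviation:
  fixes p c :: real
  assumes p: "0 < p" "p < 1" and "c > 1"
  obtains A x :: real where "A > 0" "x > 0"
    "\<And>n a. 0 < n \<Longrightarrow> A * sqrt n \<le> a \<Longrightarrow> a \<le> x * n \<Longrightarrow>
      exp (- c * a\<^sup>2 / (2 * (p * (1 - p)) * n)) / 2 \<le> measure_pmf.prob (binomial_pmf n p) {k. n * p + a \<le> k}"
proof -
  define v where "v = p * (1 - p)"
  have v: "v > 0"
    using p by (simp add: v_def)
  define D where "D y = (p + y) * ln ((p + y) / p) + (1 - (p + y)) * ln ((1 - (p + y)) / (1 - p))" for y
  define L where "L y = ln ((p + y) / p) - ln ((1 - (p + y)) / (1 - p))" for y
  have "(1 + c) / 2 > 1"
    using \<open>c > 1\<close> by simp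
  from tilt_cost_asymptotics[OF p this] obtain y0 where y0: "y0 > 0"
    and "\<And>y. 0 < y \<Longrightarrow> y < y0 \<Longrightarrow> p + y < 1 \<and> D y \<le> ((1 + c) / 2) * y\<^sup>2 / (2 * v) \<and> L y \<le> 2 * y / v"
    unfolding eventually_at_right_field D_def L_def v_def by auto
  then have y: "p + y < 1" "D y \<le> ((1 + c) / 2) * y\<^sup>2 / (2 * v)" "L y \<le> 2 * y / v"
    if "0 < y" "y < y0" for y
    using that by blast+
  \<comment> \<open>With \<open>(1 + c) / 2\<close> for the relative entropy, the rest of the factor \<open>c\<close> absorbs the errors from
    the shift by \<open>sqrt n\<close> and from the log odds, which are of relative size \<open>1 / A\<close>.\<close>
  have "((\<lambda>A. (1 + c) / 2 * (1 + 1 / A)\<^sup>2 + 4 * (1 + 1 / A) / A) \<longlongrightarrow> (1 + c) / 2) at_top"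
    by real_asymp
  moreover have "(1 + c) / 2 < c"
    using \<open>c > 1\<close> by simp
  ultimately have "\<forall>\<^sub>F A in at_top. (1 + c) / 2 * (1 + 1 / A)\<^sup>2 + 4 * (1 + 1 / A) / A < c"
    by (rule order_tendstoD)
  from eventually_happens'[OF trivial_limit_at_top_linorder eventually_conj[OF this eventually_ge_at_top[of 1]]]
  obtain A where A: "(1 + c) / 2 * (1 + 1 / A)\<^sup>2 + 4 * (1 + 1 / A) / A < c" "A \<ge> 1"
    by blast
  show ?thesis
  proof (rule that)
    show "A > 0" "y0 / 4 > 0"
      using A y0 by auto
  next
    fix n :: nat and a :: real
    assume n: "0 < n" and a: "A * sqrt n \<le> a" "a \<le> y0 / 4 * n"
    define y where "y = (a + sqrt n) / n"
    have sn: "sqrt n > 0" "sqrt n * sqrt n = n"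
      using n by auto
    have "sqrt n \<le> a / A"
      using a A by (simp add: field_simps)
    then have le: "a + sqrt n \<le> (1 + 1 / A) * a"
      by (simp add: algebra_simps)
    have a0: "a > 0"
      using a A sn by (smt (verit) mult_pos_pos)
    have y_pos: "0 < y"
      unfolding y_def using a0 sn n by (intro divide_pos_pos add_pos_pos) auto
    have "(1 + 1 / A) * a \<le> 2 * a"
      using A a0 by (intro mult_right_mono) auto
    with le have "a + sqrt n \<le> 2 * a"
      by (rule order_trans)
    moreover have "0 < y0 * n"
      using n y0 by simp
    ultimately have "a + sqrt n < y0 * n"
      using a by linarith
    then have y_less: "y < y0"
      using n by (simp add: y_def divide_less_eq)
    note y = y[OF y_pos y_less]
    have "0 \<le> ln ((p + y) / p)"
      using p y_pos by (intro ln_ge_zero) auto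
    moreover have "ln ((1 - (p + y)) / (1 - p)) \<le> 0"
      using p y(1) y_pos by (subst ln_le_zero_iff) auto
    ultimately have L0: "0 \<le> L y"
      by (simp add: L_def)
    have 1: "n * D y + sqrt n * L y \<le> c * a\<^sup>2 / (2 * v * n)"
    proof -
      have "n * D y \<le> n * (((1 + c) / 2) * y\<^sup>2 / (2 * v))"
        using y by (intro mult_left_mono) auto
      also have "\<dots> = ((1 + c) / 2) * (a + sqrt n)\<^sup>2 / (2 * v * n)"
        using n v by (simp add: y_def power2_eq_square divide_simps)
      also have "\<dots> \<le> ((1 + c) / 2) * ((1 + 1 / A) * a)\<^sup>2 / (2 * v * n)"
        using le a0 v n \<open>c > 1\<close> by (intro divide_right_mono mult_left_mono power_mono) auto
      finally have D: "n * D y \<le> (1 + c) / 2 * (1 + 1 / A)\<^sup>2 * (a\<^sup>2 / (2 * v * n))"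
        by (simp add: power_mult_distrib)
      have "sqrt n * L y \<le> sqrt n * (2 * y / v)"
        using y by (intro mult_left_mono) auto
      also have "\<dots> = 2 * (a + sqrt n) * sqrt n / (v * n)"
        by (simp add: y_def mult_ac)
      also have "\<dots> \<le> 2 * ((1 + 1 / A) * a) * (a / A) / (v * n)"
        using le a0 v n A sn \<open>sqrt n \<le> a / A\<close> by (intro divide_right_mono mult_mono mult_left_mono) auto
      also have "\<dots> = 4 * (1 + 1 / A) / A * (a\<^sup>2 / (2 * v * n))"
        using A v n by (simp add: power2_eq_square divide_simps)
      finally have "sqrt n * L y \<le> 4 * (1 + 1 / A) / A * (a\<^sup>2 / (2 * v * n))" .
      with D have "n * D y + sqrt n * L y \<le>
          (1 + c) / 2 * (1 + 1 / A)\<^sup>2 * (a\<^sup>2 / (2 * v * n)) + 4 * (1 + 1 / A) / A * (a\<^sup>2 / (2 * v * n))"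
        by (rule add_mono)
      also have "\<dots> = ((1 + c) / 2 * (1 + 1 / A)\<^sup>2 + 4 * (1 + 1 / A) / A) * (a\<^sup>2 / (2 * v * n))"
        by (rule distrib_right[symmetric])
      also have "\<dots> \<le> c * (a\<^sup>2 / (2 * v * n))"
        using A v by (intro mult_right_mono) auto
      finally show ?thesis
        by simp
    qed
    define S where "S = {k. \<bar>real k - n * (p + y)\<bar> < sqrt n}"
    interpret binomial_distribution n "p + y"
      using p y_pos y by unfold_locales auto
    have "measure_pmf.prob (binomial_pmf n (p + y)) {k. sqrt n \<le> \<bar>real k - n * (p + y)\<bar>} \<le>
      2 * exp (- 2 * (sqrt n)\<^sup>2 / n)"
      using n by (intro prob_abs_ge) auto
    also have "\<dots> = 2 * exp (- 2)"
      using n by simp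
    also have "\<dots> \<le> 1 / 2"
      using exp_ge_one_plus_x_over_n_power_n[of 4 2] by (simp add: exp_minus field_simps)
    finally have "1 / 2 \<le> 1 - measure_pmf.prob (binomial_pmf n (p + y)) {k. sqrt n \<le> \<bar>real k - n * (p + y)\<bar>}"
      by simp
    also have "\<dots> = measure_pmf.prob (binomial_pmf n (p + y)) S"
      by (subst measure_pmf.prob_compl[symmetric]) (auto simp: S_def intro!: arg_cong2[of _ _ _ _ measure])
    also have "\<dots> = measure_pmf.prob (binomial_pmf n (p + y)) (S \<inter> {..n})"
      using assms(1,2) y_pos y by (subst measure_Int_set_pmf[symmetric]) simp
    finally have half: "1 / 2 \<le> measure_pmf.prob (binomial_pmf n (p + y)) (S \<inter> {..n})" .
    have "exp (- c * a\<^sup>2 / (2 * v * n)) * (1 / 2) \<le>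
      exp (- (n * D y + sqrt n * L y)) * measure_pmf.prob (binomial_pmf n (p + y)) (S \<inter> {..n})"
      using 1 half by (intro mult_mono) auto
    also have "\<dots> \<le> measure_pmf.prob (binomial_pmf n p) (S \<inter> {..n})"
    proof (rule prob_pmf_change_of_measure)
      fix k assume k: "k \<in> S \<inter> {..n}"
      have "(k - n * (p + y)) * L y \<le> sqrt n * L y"
        using k L0 by (intro mult_right_mono) (auto simp: S_def)
      then have "exp (- (n * D y + sqrt n * L y)) \<le> exp (- (n * D y) - (k - n * (p + y)) * L y)"
        by simp
      then have "exp (- (n * D y + sqrt n * L y)) * pmf (binomial_pmf n (p + y)) k \<le>
        pmf (binomial_pmf n (p + y)) k * exp (- (n * D y) - (k - n * (p + y)) * L y)"
        by (subst mult.commute) (intro mult_left_mono pmf_nonneg)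
      also have "\<dots> = pmf (binomial_pmf n p) k"
        using k assms(1,2) y_pos y by (simp only: D_def L_def) (subst pmf_binomial_tilt[symmetric], auto)
      finally show "exp (- (n * D y + sqrt n * L y)) * pmf (binomial_pmf n (p + y)) k \<le> pmf (binomial_pmf n p) k" .
    qed auto
    also have "\<dots> \<le> measure_pmf.prob (binomial_pmf n p) {k. n * p + a \<le> k}"
    proof (intro measure_pmf.finite_measure_mono subsetI)
      fix k assume "k \<in> S \<inter> {..n}"
      then have "n * (p + y) - sqrt n < k"
        by (auto simp: S_def)
      moreover have "n * (p + y) = n * p + a + sqrt n"
        using n by (simp add: y_def field_simps)
      ultimately show "k \<in> {k. n * p + a \<le> k}"
        by simp
    qed auto
    finally show "exp (- c * a\<^sup>2 / (2 * (p * (1 - p)) * n)) / 2 \<le> measure_pmf.prob (binomial_pmf n p) {k. n * p + a \<le> k}"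
      by (simp add: v_def)
  qed
qed

section \<open>Bernoulli processes and their independent blocks\<close>

text \<open>The weight of a word is what the cylinder condition of a Bernoulli process prescribes.\<close>

lemma pmf_coin_words:
  assumes "0 \<le> p" "p \<le> 1"
  shows "pmf (coin_words n p) w = (if length w = n then \<Prod>b\<leftarrow>w. if b then p else 1 - p else 0)"
proof (induction n arbitrary: w)
  case 0
  show ?case by (auto simp: indicator_def)
next
  case (Suc n)
  have preimage: "(#) b -` {w} = (case w of [] \<Rightarrow> {} | x # v \<Rightarrow> if x = b then {v} else {})" for b
    by (cases w) auto
  have "measure_pmf.prob (coin_words n p \<bind> (\<lambda>xs. return_pmf (b # xs))) {w} =
      (case w of [] \<Rightarrow> 0 | x # v \<Rightarrow> if x = b then pmf (coin_words n p) v else 0)" for b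
    unfolding map_pmf_def[symmetric] measure_map_pmf preimage
    by (auto simp: measure_pmf_single split: list.split)
  then have "measure_pmf.prob (coin_words (Suc n) p) {w} =
      (case w of [] \<Rightarrow> 0 | x # v \<Rightarrow> (if x then p else 1 - p) * pmf (coin_words n p) v)"
    using assms by (simp add: prob_bind_bernoulli del: measure_pmf_single split: list.split)
  then show ?case
    by (simp add: Suc measure_pmf_single split: list.split)
qed

text \<open>Independence of disjoint blocks of letters, in the only form that is used.\<close>

lemma prob_coin_words_append:
  "measure_pmf.prob (coin_words (n + k) p) {w. P (take n w) \<and> Q (drop n w)} =
    measure_pmf.prob (coin_words n p) {w. P w} * measure_pmf.prob (coin_words k p) {w. Q w}"
proof -
  have len: "length xs = n" if "xs \<in> set_pmf (coin_words n p)" for xs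
    using that by (auto simp: set_replicate_pmf)
  have "coin_words (n + k) p = map_pmf (\<lambda>(xs, ys). xs @ ys) (pair_pmf (coin_words n p) (coin_words k p))"
    by (simp add: replicate_pmf_distrib pair_pmf_def map_bind_pmf)
  then have "measure_pmf.prob (coin_words (n + k) p) {w. P (take n w) \<and> Q (drop n w)} =
    measure_pmf.prob (pair_pmf (coin_words n p) (coin_words k p))
      {x. P (take n (fst x @ snd x)) \<and> Q (drop n (fst x @ snd x))}"
    by (simp add: vimage_def case_prod_beta)
  also have "\<dots> = measure_pmf.prob (pair_pmf (coin_words n p) (coin_words k p)) ({w. P w} \<times> {w. Q w})"
    by (intro measure_pmf.finite_measure_eq_AE) (auto simp: AE_measure_pmf_iff len)
  also have "\<dots> = measure_pmf.prob (coin_words n p) {w. P w} * measure_pmf.prob (coin_words k p) {w. Q w}"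
    by (intro measure_pmf_prob_product) auto
  finally show ?thesis .
qed

lemma prob_ones_coin_words:
  assumes "0 \<le> p" "p \<le> 1"
  shows "measure_pmf.prob (coin_words n p) {w. P (ones w)} = measure_pmf.prob (binomial_pmf n p) {k. P k}"
  using assms by (simp add: binomial_pmf_altdef vimage_def length_filter_id del: id_apply)

definition lil_scale :: "real \<Rightarrow> real" where
  "lil_scale u = sqrt (2 * u * ln (ln u))"

lemma ln_ge_1_of_ge_3:
  fixes u :: real
  assumes "3 \<le> u"
  shows "1 \<le> ln u"
  using assms exp_le by (subst ln_ge_iff) auto

lemma lil_scale_mono:
  assumes "3 \<le> u" "u \<le> u'"
  shows "lil_scale u \<le> lil_scale u'"
  unfolding lil_scale_def using assms ln_ge_1_of_ge_3[OF assms(1)]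
  by (intro real_sqrt_le_mono mult_mono) auto

text \<open>Independent identically distributed coins, described through the probabilities of cylinders. This
is the form in which the digits of a Bernoulli product are given, and by \<open>distr_prefix\<close> it
is all that statements about finitely many coins require.\<close>

locale bernoulli_process = prob_space M for M +
  fixes p :: real and X :: "nat \<Rightarrow> 'a \<Rightarrow> bool"
  assumes p: "0 < p" "p < 1"
    and measurable_X [measurable]: "\<And>i. X i \<in> measurable M (count_space UNIV)"
    and prob_cylinder: "\<And>w. prob {\<omega>\<in>space M. map (\<lambda>i. X i \<omega>) [0..<length w] = w} =
      (\<Prod>b\<leftarrow>w. if b then p else 1 - p)"
begin

lemma measurable_block [measurable]:
  "(\<lambda>\<omega>. map (\<lambda>i. X i \<omega>) xs) \<in> measurable M (count_space UNIV)"
proof -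
  have pred: "Measurable.pred M (\<lambda>\<omega>. map (\<lambda>i. X i \<omega>) xs = w)" for w
  proof (induction xs arbitrary: w)
    case (Cons x xs)
    show ?case
    proof (cases w)
      case (Cons b v)
      note [measurable] = Cons.IH[of v]
      show ?thesis
        unfolding Cons list.map list.inject by measurable
    qed auto
  qed auto
  show ?thesis
    using pred by (subst measurable_count_space_eq2_countable)
      (auto simp: vimage_def Int_def conj_commute pred_def)
qed

lemma distr_prefix:
  "distr M (count_space UNIV) (\<lambda>\<omega>. map (\<lambda>i. X i \<omega>) [0..<n]) = measure_pmf (coin_words n p)"
proof (rule measure_eqI_countable[where A = UNIV])
  fix w :: "bool list"
  have "emeasure (distr M (count_space UNIV) (\<lambda>\<omega>. map (\<lambda>i. X i \<omega>) [0..<n])) {w} =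
      emeasure M {\<omega>\<in>space M. map (\<lambda>i. X i \<omega>) [0..<n] = w}"
    by (subst emeasure_distr) (auto intro!: arg_cong2[of _ _ _ _ emeasure])
  also have "\<dots> = ennreal (pmf (coin_words n p) w)"
  proof (cases "length w = n")
    case True
    then show ?thesis
      using p prob_cylinder[of w] by (simp add: pmf_coin_words emeasure_eq_measure)
  next
    case False
    then have "{\<omega>\<in>space M. map (\<lambda>i. X i \<omega>) [0..<n] = w} = {}"
      by auto
    with False show ?thesis
      using p by (simp only: pmf_coin_words) simp
  qed
  finally show "emeasure (distr M (count_space UNIV) (\<lambda>\<omega>. map (\<lambda>i. X i \<omega>) [0..<n])) {w} =
      emeasure (measure_pmf (coin_words n p)) {w}"
    by (simp add: emeasure_pmf_single)
qed auto

lemma prob_prefix: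
  "prob {\<omega>\<in>space M. P (map (\<lambda>i. X i \<omega>) [0..<n])} = measure_pmf.prob (coin_words n p) {w. P w}"
  unfolding distr_prefix[symmetric]
  by (subst measure_distr) (auto intro!: arg_cong2[of _ _ _ _ measure])

lemma prob_prefix_block:
  "prob {\<omega>\<in>space M. P (map (\<lambda>i. X i \<omega>) [0..<n]) \<and> Q (map (\<lambda>i. X i \<omega>) [n..<n + k])} =
    measure_pmf.prob (coin_words n p) {w. P w} * measure_pmf.prob (coin_words k p) {w. Q w}"
  using prob_prefix[of "\<lambda>w. P (take n w) \<and> Q (drop n w)" "n + k"]
  by (simp add: prob_coin_words_append take_map drop_map)

lemma prob_block:
  "prob {\<omega>\<in>space M. Q (map (\<lambda>i. X i \<omega>) [n..<n + k])} = measure_pmf.prob (coin_words k p) {w. Q w}"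
  using prob_prefix_block[of "\<lambda>_. True" n Q k] by simp

text \<open>The second Borel--Cantelli lemma for consecutive blocks: the probability that no block with index
between \<open>K\<close> and \<open>K + J\<close> succeeds is the product of the failure probabilities, at most
\<open>exp\<close> of minus the sum of the success probabilities, which is unbounded in \<open>J\<close>.\<close>

lemma AE_frequently_block:
  fixes N :: "nat \<Rightarrow> nat"
  assumes "mono N"
    and div: "\<not> summable (\<lambda>k. measure_pmf.prob (coin_words (N (Suc k) - N k) p) {w. W k w})"
  shows "AE \<omega> in M. \<exists>\<^sub>F k in sequentially. W k (map (\<lambda>i. X i \<omega>) [N k..<N (Suc k)])"
proof -
  define q where "q k = measure_pmf.prob (coin_words (N (Suc k) - N k) p) {w. W k w}" for k
  have le: "N i \<le> N j" if "i \<le> j" for i j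
    using \<open>mono N\<close> that by (rule monoD)
  have prod: "prob {\<omega>\<in>space M. \<forall>k\<in>{K..<K + J}. \<not> W k (map (\<lambda>i. X i \<omega>) [N k..<N (Suc k)])} =
      (\<Prod>k\<in>{K..<K + J}. 1 - q k)" for K J
  proof (induction J)
    case 0
    show ?case by (simp add: prob_space)
  next
    case (Suc J)
    let ?P = "\<lambda>w. \<forall>k\<in>{K..<K + J}. \<not> W k (drop (N k) (take (N (Suc k)) w))"
    let ?n = "N (K + J)" and ?k = "N (Suc (K + J)) - N (K + J)"
    have P: "?P (map (\<lambda>i. X i \<omega>) [0..<?n]) \<longleftrightarrow>
        (\<forall>k\<in>{K..<K + J}. \<not> W k (map (\<lambda>i. X i \<omega>) [N k..<N (Suc k)]))" for \<omega>
      by (intro ball_cong) (auto simp: take_map drop_map le)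
    have k: "?n + ?k = N (Suc (K + J))"
      by (simp add: le)
    have "prob {\<omega>\<in>space M. \<forall>k\<in>{K..<K + Suc J}. \<not> W k (map (\<lambda>i. X i \<omega>) [N k..<N (Suc k)])} =
      prob {\<omega>\<in>space M. ?P (map (\<lambda>i. X i \<omega>) [0..<?n]) \<and>
        \<not> W (K + J) (map (\<lambda>i. X i \<omega>) [?n..<?n + ?k])}"
      unfolding P k by (intro arg_cong2[of _ _ _ _ measure]) (auto simp: less_Suc_eq)
    also have "\<dots> = prob {\<omega>\<in>space M. ?P (map (\<lambda>i. X i \<omega>) [0..<?n])} *
        measure_pmf.prob (coin_words ?k p) {w. \<not> W (K + J) w}"
      by (simp only: prob_prefix[of ?P ?n] prob_prefix_block[of ?P ?n "\<lambda>w. \<not> W (K + J) w" ?k])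
    also have "measure_pmf.prob (coin_words ?k p) {w. \<not> W (K + J) w} = 1 - q (K + J)"
      unfolding q_def by (subst measure_pmf.prob_compl[symmetric])
        (auto intro!: arg_cong2[of _ _ _ _ measure])
    finally show ?case
      using Suc by (simp add: P)
  qed
  have q: "0 \<le> q k" "q k \<le> 1" for k
    by (auto simp: q_def)
  have unbdd: "\<exists>J. B \<le> (\<Sum>k\<in>{K..<K + J}. q k)" for B K
  proof (rule ccontr)
    assume no: "\<nexists>J. B \<le> (\<Sum>k\<in>{K..<K + J}. q k)"
    have "summable (\<lambda>j. q (j + K))"
    proof (rule bounded_imp_summable)
      show "(\<Sum>j\<le>n. q (j + K)) \<le> B" for n
      proof -
        have "(\<Sum>j\<le>n. q (j + K)) = (\<Sum>k\<in>{K..<K + Suc n}. q k)"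
          by (rule sum.reindex_bij_witness[of _ "\<lambda>k. k - K" "\<lambda>j. j + K"]) auto
        with no show ?thesis
          by (metis linear)
      qed
    qed (rule q)
    then have "summable q"
      by (simp add: summable_iff_shift)
    with div show False
      by (simp add: q_def[abs_def])
  qed
  have "AE \<omega> in M. \<exists>k\<ge>K. W k (map (\<lambda>i. X i \<omega>) [N k..<N (Suc k)])" for K
  proof -
    let ?Z = "{\<omega>\<in>space M. \<forall>k\<ge>K. \<not> W k (map (\<lambda>i. X i \<omega>) [N k..<N (Suc k)])}"
    have [measurable]: "?Z \<in> sets M"
      by measurable
    have le: "prob ?Z \<le> exp (- B)" for B
    proof -
      obtain J where J: "B \<le> (\<Sum>k\<in>{K..<K + J}. q k)"
        using unbdd by blast
      have "prob ?Z \<le> prob {\<omega>\<in>space M. \<forall>k\<in>{K..<K + J}. \<not> W k (map (\<lambda>i. X i \<omega>) [N k..<N (Suc k)])}"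
        by (intro finite_measure_mono) auto
      also have "\<dots> \<le> (\<Prod>k\<in>{K..<K + J}. exp (- q k))"
        unfolding prod using q exp_ge_add_one_self[of "- q _"] by (intro prod_mono) auto
      also have "\<dots> \<le> exp (- B)"
        using J by (simp add: exp_sum[symmetric] sum_negf)
      finally show ?thesis .
    qed
    have "prob ?Z = 0"
    proof (rule ccontr)
      assume "prob ?Z \<noteq> 0"
      then have "prob ?Z > 0"
        by (simp add: zero_less_measure_iff)
      with le[of "- ln (prob ?Z / 2)"] show False
        by simp
    qed
    then show ?thesis
      by (subst AE_iff_measurable[OF \<open>?Z \<in> sets M\<close>]) (auto simp: emeasure_eq_measure)
  qed
  then have "AE \<omega> in M. \<forall>K. \<exists>k\<ge>K. W k (map (\<lambda>i. X i \<omega>) [N k..<N (Suc k)])"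
    by (simp add: AE_all_countable)
  then show ?thesis
    by (simp add: frequently_sequentially)
qed

end

section \<open>The law of the iterated logarithm: upper half\<close>

text \<open>The value of the Chernoff exponent at the optimal parameter \<open>l\<close>, for \<open>c * u\<close> steps whose variance is
overestimated by the factor \<open>c\<close>.\<close>

lemma chernoff_optimised:
  fixes v c u a l :: real
  assumes "v > 0" "c > 0" "u > 0" and l: "l = a / (v * c\<^sup>2 * u)"
  shows "- l * a + c * v * l\<^sup>2 / 2 * (c * u) = - (a\<^sup>2 / (2 * v * c\<^sup>2 * u))"
  unfolding l using assms(1-3) by (simp add: divide_simps power2_eq_square)

lemma geometric_bracket:
  fixes c x :: real
  assumes "c > 1" "x \<ge> 1"
  obtains k where "c ^ k \<le> x" "x < c ^ Suc k"
proof -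
  define k where "k = (LEAST k. x < c ^ Suc k)"
  obtain n where "x < c ^ n"
    using real_arch_pow[OF \<open>c > 1\<close>] by blast
  also have "\<dots> \<le> c ^ Suc n"
    using \<open>c > 1\<close> by simp
  finally have less: "x < c ^ Suc k"
    unfolding k_def by (rule LeastI)
  have "c ^ k \<le> x"
  proof (cases k)
    case (Suc j)
    then have "\<not> x < c ^ Suc j"
      using not_less_Least[of j "\<lambda>k. x < c ^ Suc k"] by (simp add: k_def)
    with Suc show ?thesis by simp
  qed (use assms in simp)
  with less show ?thesis by (intro that)
qed

context bernoulli_process
begin

abbreviation wins :: "nat \<Rightarrow> 'a \<Rightarrow> nat" where
  "wins n \<omega> \<equiv> ones (map (\<lambda>i. X i \<omega>) [0..<n])"

lemma prob_max_excess:
  assumes "l \<ge> 0"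
  shows "prob {\<omega>\<in>space M. \<exists>j\<le>n. a \<le> wins j \<omega> - j * p} \<le>
    exp (- l * a) * (p * exp (l * (1 - p)) + (1 - p) * exp (- l * p)) ^ n"
proof -
  have "prob {\<omega>\<in>space M. \<exists>j\<le>n. a \<le> wins j \<omega> - j * p} =
    prob {\<omega>\<in>space M. \<exists>j\<le>n. a \<le> ones (take j (map (\<lambda>i. X i \<omega>) [0..<n])) - j * p}"
    by (intro arg_cong2[of _ _ _ _ measure] Collect_cong conj_cong ex_cong) (auto simp: take_map)
  also have "\<dots> \<le> exp (- l * a) * (p * exp (l * (1 - p)) + (1 - p) * exp (- l * p)) ^ n"
    unfolding prob_prefix[of "\<lambda>w. \<exists>j\<le>n. a \<le> ones (take j w) - j * p"]
    using p assms by (intro prob_max_excess_coin_words) auto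
  finally show ?thesis .
qed

text \<open>In the geometric block from \<open>c ^ k\<close> to \<open>c ^ Suc k\<close> the excess is compared with \<open>\<beta>\<close> times the scale at
the beginning of the block. One factor \<open>c\<close> is lost to the length of the block and one to the moment
generating function; the maximal inequality then gives \<open>ln (c ^ k) powr (- \<beta>\<^sup>2 / c\<^sup>2)\<close>,
a constant multiple of a power of \<open>k\<close> with exponent below \<open>- 1\<close>.\<close>

lemma summable_max_excess:
  fixes c \<beta> :: real
  assumes c: "c > 1" and "\<beta> > c"
  shows "summable (\<lambda>k. prob {\<omega>\<in>space M. \<exists>j\<le>nat \<lfloor>c ^ Suc k\<rfloor>.
    \<beta> * sqrt (p * (1 - p)) * lil_scale (c ^ k) \<le> wins j \<omega> - j * p})"
proof -
  define v where "v = p * (1 - p)"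
  have v: "v > 0" using p by (simp add: v_def)
  define a where "a k = \<beta> * sqrt v * lil_scale (c ^ k)" for k
  \<comment> \<open>the minimiser of the Chernoff exponent; it tends to \<open>0\<close>, where \<open>mgf_coin_bound\<close> applies\<close>
  define l where "l k = a k / (v * c\<^sup>2 * c ^ k)" for k
  have "ln c > 0" using c by simp
  have "filterlim (\<lambda>k::nat. ln (ln (c ^ k))) at_top sequentially"
    using c \<open>ln c > 0\<close> by real_asymp
  then have lnln: "\<forall>\<^sub>F k in sequentially. ln (ln (c ^ k)) > 0"
    by (simp add: filterlim_at_top_dense)
  have "(\<lambda>k::nat. sqrt (2 * c ^ k * ln (ln (c ^ k))) / c ^ k) \<longlonglongrightarrow> 0"
    using c \<open>ln c > 0\<close> by real_asymp
  then have "(\<lambda>k. \<beta> * sqrt v / (v * c\<^sup>2) * (lil_scale (c ^ k) / c ^ k)) \<longlonglongrightarrow> 0"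
    unfolding lil_scale_def by (intro tendsto_mult_right_zero)
  then have "l \<longlonglongrightarrow> 0"
    by (simp add: l_def[abs_def] a_def)
  moreover have l_pos: "\<forall>\<^sub>F k in sequentially. l k > 0"
    using lnln by eventually_elim (use v c \<open>\<beta> > c\<close> in \<open>simp add: l_def a_def lil_scale_def\<close>)
  ultimately have "filterlim l (at_right 0) sequentially"
    by (rule tendsto_imp_filterlim_at_right)
  from filterlim_iff[THEN iffD1, OF this, rule_format, OF mgf_coin_bound[OF p c]]
  have mgf: "\<forall>\<^sub>F k in sequentially. p * exp (l k * (1 - p)) + (1 - p) * exp (- l k * p) \<le>
      exp (c * v * (l k)\<^sup>2 / 2)"
    by (simp add: v_def)
  have "\<forall>\<^sub>F k in sequentially. norm (prob {\<omega>\<in>space M. \<exists>j\<le>nat \<lfloor>c ^ Suc k\<rfloor>. a k \<le> wins j \<omega> - j * p}) \<le>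
      ln c powr - (\<beta>\<^sup>2 / c\<^sup>2) * real k powr - (\<beta>\<^sup>2 / c\<^sup>2)"
    using mgf l_pos lnln eventually_gt_at_top[of 0]
  proof eventually_elim
    case (elim k)
    let ?\<phi> = "p * exp (l k * (1 - p)) + (1 - p) * exp (- l k * p)"
    have \<phi>0: "?\<phi> \<ge> 0" using p by simp
    have N: "real (nat \<lfloor>c ^ Suc k\<rfloor>) \<le> c * c ^ k"
      using c by simp
    have "norm (prob {\<omega>\<in>space M. \<exists>j\<le>nat \<lfloor>c ^ Suc k\<rfloor>. a k \<le> wins j \<omega> - j * p}) \<le>
        exp (- l k * a k) * ?\<phi> ^ nat \<lfloor>c ^ Suc k\<rfloor>"
      using elim prob_max_excess[of "l k"] by simp
    also have "\<dots> \<le> exp (- l k * a k) * exp (c * v * (l k)\<^sup>2 / 2) ^ nat \<lfloor>c ^ Suc k\<rfloor>"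
      using elim \<phi>0 by (intro mult_left_mono power_mono) auto
    also have "\<dots> = exp (- l k * a k + real (nat \<lfloor>c ^ Suc k\<rfloor>) * (c * v * (l k)\<^sup>2 / 2))"
      by (simp only: exp_add exp_of_nat_mult)
    also have "\<dots> \<le> exp (- l k * a k + c * v * (l k)\<^sup>2 / 2 * (c * c ^ k))"
      using mult_right_mono[OF N, of "c * v * (l k)\<^sup>2 / 2"] c v by (simp add: mult_ac)
    also have "\<dots> = exp (- ((a k)\<^sup>2 / (2 * v * c\<^sup>2 * c ^ k)))"
      using v c by (subst chernoff_optimised[where a = "a k"]) (auto simp: l_def)
    also have "(a k)\<^sup>2 / (2 * v * c\<^sup>2 * c ^ k) = \<beta>\<^sup>2 / c\<^sup>2 * ln (ln (c ^ k))"
      using v c elim by (simp add: a_def lil_scale_def power_mult_distrib)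
    also have "exp (- (\<beta>\<^sup>2 / c\<^sup>2 * ln (ln (c ^ k)))) = ln (c ^ k) powr - (\<beta>\<^sup>2 / c\<^sup>2)"
      using c elim by (auto simp: powr_def)
    also have "\<dots> = ln c powr - (\<beta>\<^sup>2 / c\<^sup>2) * real k powr - (\<beta>\<^sup>2 / c\<^sup>2)"
      using c elim by (simp add: ln_realpow powr_mult mult.commute)
    finally show ?case .
  qed
  moreover have "c\<^sup>2 < \<beta>\<^sup>2"
    using assms by (intro power_strict_mono) auto
  then have "summable (\<lambda>k. ln c powr - (\<beta>\<^sup>2 / c\<^sup>2) * real k powr - (\<beta>\<^sup>2 / c\<^sup>2))"
    using c by (intro summable_mult) (simp add: summable_real_powr_iff)
  ultimately show ?thesis
    unfolding a_def v_def by (rule summable_comparison_test_ev)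
qed

text \<open>By Borel--Cantelli only finitely many geometric blocks contain a large excess; inside a block
the scale is at least its value at the left end.\<close>

theorem lil_upper:
  assumes "\<epsilon> > 0"
  shows "AE \<omega> in M. \<forall>\<^sub>F n in sequentially. wins n \<omega> - n * p \<le> (1 + \<epsilon>) * sqrt (p * (1 - p)) * lil_scale n"
proof -
  define c where "c = 1 + \<epsilon> / 2"
  have c: "c > 1" "1 + \<epsilon> > c"
    using assms by (auto simp: c_def)
  let ?E = "\<lambda>k. {\<omega>\<in>space M. \<exists>j\<le>nat \<lfloor>c ^ Suc k\<rfloor>.
    (1 + \<epsilon>) * sqrt (p * (1 - p)) * lil_scale (c ^ k) \<le> wins j \<omega> - j * p}"
  have "AE \<omega> in M. \<forall>\<^sub>F k in sequentially. \<omega> \<in> space M - ?E k"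
    by (rule borel_cantelli_AE1) (use summable_max_excess[OF c] in \<open>auto simp: less_top[symmetric]\<close>)
  then show ?thesis
  proof (rule AE_mp, intro AE_I2 impI)
    fix \<omega> assume \<omega>: "\<omega> \<in> space M" and "\<forall>\<^sub>F k in sequentially. \<omega> \<in> space M - ?E k"
    then have "\<forall>\<^sub>F k in sequentially. \<omega> \<notin> ?E k"
      by simp
    moreover have "\<forall>\<^sub>F k in sequentially. 3 \<le> c ^ k"
      using c by real_asymp
    ultimately have "\<forall>\<^sub>F k in sequentially. 3 \<le> c ^ k \<and> \<omega> \<notin> ?E k"
      by eventually_elim auto
    then obtain K where K: "\<And>k. k \<ge> K \<Longrightarrow> 3 \<le> c ^ k \<and> \<omega> \<notin> ?E k"
      by (auto simp: eventually_sequentially)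
    have "\<forall>\<^sub>F n::nat in sequentially. c ^ Suc K \<le> n" "\<forall>\<^sub>F n::nat in sequentially. 1 \<le> n"
      by real_asymp+
    then show "\<forall>\<^sub>F n in sequentially. wins n \<omega> - n * p \<le> (1 + \<epsilon>) * sqrt (p * (1 - p)) * lil_scale n"
    proof eventually_elim
      case (elim n)
      obtain k where k: "c ^ k \<le> n" "n < c ^ Suc k"
        using geometric_bracket[OF c(1), of n] elim by auto
      have "c ^ Suc K < c ^ Suc k"
        using elim k by simp
      then have "K \<le> k"
        using c by (subst (asm) power_strict_increasing_iff) auto
      moreover have "n \<le> nat \<lfloor>c ^ Suc k\<rfloor>"
        using k by (simp add: le_nat_floor)
      moreover have "\<forall>j\<le>nat \<lfloor>c ^ Suc k\<rfloor>. \<not> (1 + \<epsilon>) * sqrt (p * (1 - p)) * lil_scale (c ^ k) \<le> wins j \<omega> - j * p"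
        using K[OF \<open>K \<le> k\<close>] \<omega> by blast
      ultimately have "wins n \<omega> - n * p \<le> (1 + \<epsilon>) * sqrt (p * (1 - p)) * lil_scale (c ^ k)"
        by (meson linear)
      also have "\<dots> \<le> (1 + \<epsilon>) * sqrt (p * (1 - p)) * lil_scale n"
        using K[OF \<open>K \<le> k\<close>] k p assms by (intro mult_left_mono lil_scale_mono) auto
      finally show ?case .
    qed
  qed
qed

end

section \<open>The law of the iterated logarithm: lower half\<close>

lemma ones_map_Not: "ones (map Not w) = length w - ones w"
  by (induction w) (auto simp: Suc_diff_le count_le_length)

text \<open>One step back in a geometric sequence with large ratio \<open>b\<close> makes the scale negligible. This is what
allows the past to be ignored in the lower half of the law of the iterated logarithm.\<close>

lemma lil_scale_geometric_le:
  fixes b :: real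
  assumes "b > 1" "b ^ k \<ge> 3"
  shows "lil_scale (b ^ k) \<le> lil_scale (b ^ Suc k) / sqrt b"
proof -
  have 1: "1 \<le> ln (b ^ k)"
    using assms by (intro ln_ge_1_of_ge_3)
  have "b ^ k > 0"
    using assms by simp
  have "ln (b ^ k) \<le> ln (b ^ Suc k)"
    using assms \<open>b ^ k > 0\<close> by simp
  then have "ln (ln (b ^ k)) \<le> ln (ln (b ^ Suc k))"
    using 1 by (subst ln_le_cancel_iff) auto
  then have "2 * b ^ k * ln (ln (b ^ k)) \<le> 2 * b ^ k * ln (ln (b ^ Suc k))"
    using \<open>b ^ k > 0\<close> by (intro mult_left_mono) auto
  also have "\<dots> = 2 * b ^ Suc k * ln (ln (b ^ Suc k)) / b"
    using assms by simp
  finally show ?thesis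
    unfolding lil_scale_def real_sqrt_divide[symmetric] by (intro real_sqrt_le_mono) 
qed

context bernoulli_process
begin

text \<open>Exchanging the two outcomes turns bounds for the number of ones into bounds for the number of zeros,
so each half of the law of the iterated logarithm serves both signs of \<open>log 2 (p / (1 - p))\<close>.\<close>

lemma complement: "bernoulli_process M (1 - p) (\<lambda>i \<omega>. \<not> X i \<omega>)"
proof unfold_locales
  fix w :: "bool list"
  have eq: "map (\<lambda>i. \<not> X i \<omega>) [0..<length w] = w \<longleftrightarrow>
      map (\<lambda>i. X i \<omega>) [0..<length (map Not w)] = map Not w" for \<omega>
  proof -
    have "map (\<lambda>i. \<not> X i \<omega>) [0..<length w] = map Not (map (\<lambda>i. X i \<omega>) [0..<length w])"
      by simp
    moreover have "map Not (map Not v) = v" for v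
      by (induction v) auto
    ultimately show ?thesis
      by (metis length_map)
  qed
  show "prob {\<omega>\<in>space M. map (\<lambda>i. \<not> X i \<omega>) [0..<length w] = w} =
      (\<Prod>b\<leftarrow>w. if b then 1 - p else 1 - (1 - p))"
    unfolding eq prob_cylinder by (induction w) auto
qed (use p in auto)

lemma wins_complement:
  "ones (map (\<lambda>i. \<not> X i \<omega>) [0..<n]) - n * (1 - p) = n * p - wins n \<omega>"
proof -
  have "ones (map (\<lambda>i. \<not> X i \<omega>) [0..<n]) = n - wins n \<omega>"
    using ones_map_Not[of "map (\<lambda>i. X i \<omega>) [0..<n]"] by (simp add: o_def)
  moreover have "wins n \<omega> \<le> n"
    using count_le_length[of "map (\<lambda>i. X i \<omega>) [0..<n]" True] by simp
  ultimately have "real (ones (map (\<lambda>i. \<not> X i \<omega>) [0..<n])) = real n - wins n \<omega>"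
    by linarith
  then show ?thesis
    unfolding right_diff_distrib by linarith
qed

lemma variance_complement: "(1 - p) * (1 - (1 - p)) = p * (1 - p)"
  by simp

lemma lil_upper_complement:
  assumes "\<epsilon> > 0"
  shows "AE \<omega> in M. \<forall>\<^sub>F n in sequentially. n * p - wins n \<omega> \<le> (1 + \<epsilon>) * sqrt (p * (1 - p)) * lil_scale n"
  using bernoulli_process.lil_upper[OF complement assms, unfolded wins_complement variance_complement] .

text \<open>The increments over the blocks from \<open>b ^ k\<close> to \<open>b ^ Suc k\<close> are large with non-summable
probabilities. The block has length \<open>(1 - 1 / b) b ^ Suc k\<close>, so the moderate deviation
bound has exponent \<open>- c \<theta>\<^sup>2 / (1 - 1 / b) * ln (ln (b ^ Suc k))\<close>, and the hypothesis on \<open>c\<close>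
makes it at least \<open>- ln (ln (b ^ Suc k))\<close>, the logarithm of a multiple of \<open>1 / Suc k\<close>.\<close>

lemma not_summable_block_excess:
  fixes b :: nat and \<theta> :: real
  assumes b: "b \<ge> 2" and \<theta>: "\<theta> > 0" and c: "c > 1" "c * \<theta>\<^sup>2 \<le> 1 - 1 / b"
  shows "\<not> summable (\<lambda>k. measure_pmf.prob (coin_words (b ^ Suc k - b ^ k) p)
    {w. (b ^ Suc k - b ^ k) * p + \<theta> * sqrt (p * (1 - p)) * lil_scale (b ^ Suc k) \<le> ones w})"
proof
  define v where "v = p * (1 - p)"
  have v: "v > 0" using p by (simp add: v_def)
  define a where "a k = \<theta> * sqrt v * lil_scale (b ^ Suc k)" for k
  define N where "N k = b ^ Suc k - b ^ k" for k
  have N: "real (N k) = (1 - 1 / b) * real b ^ Suc k" for k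
    using b by (simp add: N_def of_nat_diff field_simps)
  obtain A x :: real where "A > 0" "x > 0" and dev:
    "\<And>n a. 0 < n \<Longrightarrow> A * sqrt n \<le> a \<Longrightarrow> a \<le> x * n \<Longrightarrow>
      exp (- c * a\<^sup>2 / (2 * v * n)) / 2 \<le> measure_pmf.prob (binomial_pmf n p) {k. n * p + a \<le> k}"
    using binomial_moderate_deviation[OF p \<open>c > 1\<close>] unfolding v_def by metis
  have b': "real b > 1" "ln (real b) > 0"
    using b by auto
  have "(\<lambda>k::nat. sqrt (2 * real b ^ Suc k * ln (ln (real b ^ Suc k))) / real b ^ Suc k) \<longlonglongrightarrow> 0"
    using b' by real_asymp
  then have "(\<lambda>k. \<theta> * sqrt v * (lil_scale (real b ^ Suc k) / real b ^ Suc k)) \<longlonglongrightarrow> 0"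
    unfolding lil_scale_def by (rule tendsto_mult_right_zero)
  moreover have "x * (1 - 1 / b) > 0"
    using \<open>x > 0\<close> b by simp
  ultimately have "\<forall>\<^sub>F k in sequentially. \<theta> * sqrt v * (lil_scale (real b ^ Suc k) / real b ^ Suc k) < x * (1 - 1 / b)"
    by (rule order_tendstoD)
  then have upper: "\<forall>\<^sub>F k in sequentially. a k \<le> x * N k"
  proof eventually_elim
    case (elim k)
    then have "a k / real b ^ Suc k < x * (1 - 1 / b)"
      by (simp add: a_def)
    then have "a k < x * (1 - 1 / b) * real b ^ Suc k"
      using b by (simp add: pos_divide_less_eq del: power_Suc)
    then show ?case
      by (simp only: N mult.assoc less_imp_le)
  qed
  have "filterlim (\<lambda>k::nat. sqrt (2 * real b ^ Suc k * ln (ln (real b ^ Suc k))) / sqrt (real b ^ Suc k)) at_top sequentially"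
    using b' by real_asymp
  then have "\<forall>\<^sub>F k in sequentially. A / (\<theta> * sqrt v) \<le> lil_scale (real b ^ Suc k) / sqrt (real b ^ Suc k)"
    unfolding lil_scale_def filterlim_at_top by blast
  then have lower: "\<forall>\<^sub>F k in sequentially. A * sqrt (N k) \<le> a k"
  proof eventually_elim
    case (elim k)
    have "sqrt (N k) \<le> sqrt (real b ^ Suc k)"
      unfolding N using b by (intro real_sqrt_le_mono mult_left_le_one_le) auto
    then have "A * sqrt (N k) \<le> A * sqrt (real b ^ Suc k)"
      using \<open>A > 0\<close> by simp
    also have "\<dots> \<le> a k"
      using elim b v \<theta> by (simp add: a_def field_simps)
    finally show ?case .
  qed
  have "\<forall>\<^sub>F k in sequentially. norm (inverse (2 * ln (real b)) * inverse (real (Suc k))) \<le>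
    measure_pmf.prob (coin_words (N k) p) {w. N k * p + a k \<le> ones w}"
    using upper lower eventually_gt_at_top[of 3]
  proof eventually_elim
    case (elim k)
    have "real b ^ Suc k \<ge> 2 ^ Suc k"
      using b by (intro power_mono) auto
    moreover have "(2::real) ^ Suc k \<ge> 2 ^ Suc 3"
      using elim by (intro power_increasing) auto
    ultimately have ge: "real b ^ Suc k \<ge> 3"
      by simp
    from ln_ge_1_of_ge_3[OF this] have ln: "ln (real b ^ Suc k) \<ge> 1" .
    then have lnln: "ln (ln (real b ^ Suc k)) \<ge> 0"
      by simp
    have "c * (a k)\<^sup>2 / (2 * v * N k) = c * \<theta>\<^sup>2 / (1 - 1 / b) * ln (ln (real b ^ Suc k))"
      using v b lnln by (simp add: a_def N lil_scale_def power_mult_distrib)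
    also have "\<dots> \<le> 1 * ln (ln (real b ^ Suc k))"
      using c b lnln by (intro mult_right_mono) auto
    finally have le: "- ln (ln (real b ^ Suc k)) \<le> - c * (a k)\<^sup>2 / (2 * v * N k)"
      by simp
    have "norm (inverse (2 * ln (real b)) * inverse (real (Suc k))) = inverse (ln (real b ^ Suc k)) / 2"
      using b' by (simp add: ln_realpow del: power_Suc)
    also have "\<dots> = exp (- ln (ln (real b ^ Suc k))) / 2"
      using ln by (simp add: exp_minus del: power_Suc)
    also have "\<dots> \<le> exp (- c * (a k)\<^sup>2 / (2 * v * N k)) / 2"
      using le by simp
    also have "\<dots> \<le> measure_pmf.prob (binomial_pmf (N k) p) {j. N k * p + a k \<le> j}"
      using elim b by (intro dev) (auto simp: N_def)
    also have "\<dots> = measure_pmf.prob (coin_words (N k) p) {w. N k * p + a k \<le> ones w}"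
      using p by (subst prob_ones_coin_words[where P = "\<lambda>j. N k * p + a k \<le> real j"]) auto
    finally show ?case .
  qed
  moreover assume "summable (\<lambda>k. measure_pmf.prob (coin_words (b ^ Suc k - b ^ k) p)
    {w. (b ^ Suc k - b ^ k) * p + \<theta> * sqrt (p * (1 - p)) * lil_scale (b ^ Suc k) \<le> ones w})"
  then have "summable (\<lambda>k. measure_pmf.prob (coin_words (N k) p) {w. N k * p + a k \<le> ones w})"
    by (simp add: N_def a_def v_def)
  ultimately have "summable (\<lambda>k. inverse (2 * ln (real b)) * inverse (real (Suc k)))"
    by (rule summable_comparison_test_ev)
  then have "summable (\<lambda>k. inverse (real (Suc k)))"
    using b' by (subst (asm) summable_cmult_iff) auto
  then show False
    using not_summable_harmonic[where 'a = real] by (simp only: summable_Suc_iff[of "\<lambda>k. inverse (real k)"])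
qed

text \<open>Infinitely many increments over the independent blocks are as large as they should be, with a factor
\<open>\<theta>'\<close> slightly above \<open>\<theta>\<close>. The sum up to the beginning of such a block could be negative, but by the
upper half for the complementary coins it is at least \<open>- 2\<close> times the earlier scale, hence at
least \<open>- 2 / sqrt b\<close> times the present one; \<open>\<theta>' = \<theta> + 2 / sqrt b\<close> pays for this.\<close>

theorem lil_lower:
  assumes \<theta>: "0 < \<theta>" "\<theta> < 1"
  shows "AE \<omega> in M. \<exists>\<^sub>F n in sequentially. \<theta> * sqrt (p * (1 - p)) * lil_scale n \<le> wins n \<omega> - n * p"
proof -
  \<comment> \<open>The factor \<open>1 / \<theta> > 1\<close> serves as the constant of the moderate deviation bound: it leaves
    \<open>1 / \<theta> * \<theta>'\<^sup>2\<close> close to \<open>\<theta> < 1\<close> when \<open>b\<close> is large.\<close>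
  have "((\<lambda>b::real. 1 / \<theta> * (\<theta> + 2 / sqrt b)\<^sup>2 + 1 / b) \<longlongrightarrow> \<theta>) at_top"
    using \<theta> by (real_asymp, simp add: power2_eq_square)
  then have "(\<lambda>b::nat. 1 / \<theta> * (\<theta> + 2 / sqrt b)\<^sup>2 + 1 / b) \<longlonglongrightarrow> \<theta>"
    by (rule filterlim_compose[OF _ filterlim_real_sequentially])
  from order_tendstoD(2)[OF this \<open>\<theta> < 1\<close>]
  have "\<forall>\<^sub>F b in sequentially. 1 / \<theta> * (\<theta> + 2 / sqrt (real b))\<^sup>2 + 1 / real b < 1" .
  from eventually_happens'[OF sequentially_bot eventually_conj[OF this eventually_ge_at_top[of 2]]]
  obtain b :: nat where b: "1 / \<theta> * (\<theta> + 2 / sqrt b)\<^sup>2 + 1 / b < 1" "b \<ge> 2"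
    by blast
  define \<theta>' where "\<theta>' = \<theta> + 2 / sqrt b"
  let ?s = "sqrt (p * (1 - p))"
  have mono: "mono (\<lambda>k. b ^ k)"
    using b by (intro monoI power_increasing) auto
  have "\<not> summable (\<lambda>k. measure_pmf.prob (coin_words (b ^ Suc k - b ^ k) p)
    {w. (b ^ Suc k - b ^ k) * p + \<theta>' * ?s * lil_scale (b ^ Suc k) \<le> ones w})"
    using b \<theta> by (intro not_summable_block_excess[where c = "1 / \<theta>"]) (auto simp: \<theta>'_def add_pos_nonneg)
  note AE_frequently_block[OF mono this]
  moreover have "AE \<omega> in M. \<forall>\<^sub>F n in sequentially. n * p - wins n \<omega> \<le> (1 + 1) * ?s * lil_scale n"
    by (rule lil_upper_complement) simp
  ultimately show ?thesis
  proof eventually_elim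
    case (elim \<omega>)
    have lim: "filterlim (\<lambda>k. b ^ k) sequentially sequentially"
    proof (rule filterlim_at_top_mono[OF filterlim_ident])
      show "\<forall>\<^sub>F k in sequentially. k \<le> b ^ k"
        using b power_gt_expt[of b] by (intro always_eventually) (auto intro: less_imp_le)
    qed
    have "\<forall>\<^sub>F k in sequentially. 3 \<le> real b ^ k"
      using b by real_asymp
    moreover have "\<forall>\<^sub>F k in sequentially. real (b ^ k) * p - wins (b ^ k) \<omega> \<le> (1 + 1) * ?s * lil_scale (real (b ^ k))"
      using elim(2) lim by (rule eventually_compose_filterlim)
    ultimately have "\<forall>\<^sub>F k in sequentially.
        real (b ^ Suc k - b ^ k) * p + \<theta>' * ?s * lil_scale (b ^ Suc k) \<le> ones (map (\<lambda>i. X i \<omega>) [b ^ k..<b ^ Suc k]) \<longrightarrow>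
        \<theta> * ?s * lil_scale (b ^ Suc k) \<le> wins (b ^ Suc k) \<omega> - (b ^ Suc k) * p"
    proof (eventually_elim, intro impI)
      fix k assume k: "3 \<le> real b ^ k"
        "real (b ^ k) * p - wins (b ^ k) \<omega> \<le> (1 + 1) * ?s * lil_scale (real (b ^ k))"
        "real (b ^ Suc k - b ^ k) * p + \<theta>' * ?s * lil_scale (b ^ Suc k) \<le> ones (map (\<lambda>i. X i \<omega>) [b ^ k..<b ^ Suc k])"
      have le: "b ^ k \<le> b ^ Suc k"
        using b by simp
      have "[0..<b ^ Suc k] = [0..<b ^ k] @ [b ^ k..<b ^ Suc k]"
        using upt_add_eq_append[of 0 "b ^ k" "b ^ Suc k - b ^ k"] le by simp
      then have sum: "wins (b ^ Suc k) \<omega> = wins (b ^ k) \<omega> + ones (map (\<lambda>i. X i \<omega>) [b ^ k..<b ^ Suc k])"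
        by (simp only: map_append count_list_append)
      have "?s * lil_scale (real b ^ k) \<le> ?s * (lil_scale (real b ^ Suc k) / sqrt b)"
        using k b p by (intro mult_left_mono lil_scale_geometric_le) auto
      then show "\<theta> * ?s * lil_scale (b ^ Suc k) \<le> wins (b ^ Suc k) \<omega> - (b ^ Suc k) * p"
        using k(2,3) le unfolding sum by (simp add: \<theta>'_def algebra_simps of_nat_diff)
    qed
    with elim(1) have "\<exists>\<^sub>F k in sequentially. \<theta> * ?s * lil_scale (b ^ Suc k) \<le> wins (b ^ Suc k) \<omega> - (b ^ Suc k) * p"
      by (rule frequently_rev_mp)
    moreover have "filterlim (\<lambda>k. b ^ Suc k) sequentially sequentially"
      using lim by (rule filterlim_compose[OF _ filterlim_Suc])
    ultimately show ?case
      unfolding frequently_def using eventually_compose_filterlim by blast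
  qed
qed

lemma lil_lower_complement:
  assumes "0 < \<theta>" "\<theta> < 1"
  shows "AE \<omega> in M. \<exists>\<^sub>F n in sequentially. \<theta> * sqrt (p * (1 - p)) * lil_scale n \<le> n * p - wins n \<omega>"
  using bernoulli_process.lil_lower[OF complement assms, unfolded wins_complement variance_complement] .

end

section \<open>Binary digits and dyadic cells\<close>

lemma ones_eq_sum_nth: "ones w = (\<Sum>i=1..length w. of_bool (w ! (i - 1)))"
proof (induction w rule: rev_induct)
  case (snoc b w)
  have "(\<Sum>i=1..length w. of_bool ((w @ [b]) ! (i - 1))) = (\<Sum>i=1..length w. of_bool (w ! (i - 1)) :: nat)"
    by (intro sum.cong) (auto simp: nth_append)
  with snoc show ?case
    by (simp del: sum_of_bool_eq)
qed simp

lemma prod_coin_weights: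
  "(\<Prod>b\<leftarrow>w. if b then p else 1 - p) = p ^ ones w * (1 - p) ^ (length w - ones w)" for p :: real
  by (induction w) (auto simp: Suc_diff_le count_le_length)

text \<open>The first letter is the most significant digit.\<close>

definition binary_value :: "bool list \<Rightarrow> int" where
  "binary_value w = foldl (\<lambda>a b. 2 * a + of_bool b) 0 w"

lemma binary_value_Nil [simp]: "binary_value [] = 0"
  and binary_value_snoc [simp]: "binary_value (w @ [b]) = 2 * binary_value w + of_bool b"
  by (simp_all add: binary_value_def)

lemma binary_value_nonneg: "0 \<le> binary_value w"
  by (induction w rule: rev_induct) auto

lemma binary_value_less: "binary_value w < 2 ^ length w"
  by (induction w rule: rev_induct) (auto simp: of_bool_def)

lemma binary_value_pos: "True \<in> set w \<Longrightarrow> 1 \<le> binary_value w"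
proof (induction w rule: rev_induct)
  case (snoc b w)
  then show ?case
    using binary_value_nonneg[of w] by (cases b) auto
qed simp

lemma binary_value_not_max: "False \<in> set w \<Longrightarrow> binary_value w + 2 \<le> 2 ^ length w"
proof (induction w rule: rev_induct)
  case (snoc b w)
  then show ?case
    using binary_value_less[of w] by (cases b) auto
qed simp

lemma binary_value_inj:
  "length v = length w \<Longrightarrow> binary_value v = binary_value w \<Longrightarrow> v = w"
proof (induction v arbitrary: w rule: rev_induct)
  case (snoc b v)
  then obtain c u where w: "w = u @ [c]"
    by (metis append_butlast_last_id length_0_conv snoc_eq_iff_butlast)
  have eq: "2 * binary_value v + of_bool b = 2 * binary_value u + of_bool c"
    using snoc w by simp
  then have "b = c"
    by (cases b; cases c) (simp_all, presburger+)
  with eq have "binary_value v = binary_value u"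
    by simp
  with snoc w \<open>b = c\<close> show ?case
    by simp
qed simp

lemma sum_binary_digits:
  "(\<Sum>i=1..length w. real (of_bool (w ! (i - 1))) / 2 ^ i) = binary_value w / 2 ^ length w"
proof (induction w rule: rev_induct)
  case (snoc b w)
  have "(\<Sum>i=1..length w. real (of_bool ((w @ [b]) ! (i - 1))) / 2 ^ i) =
      (\<Sum>i=1..length w. real (of_bool (w ! (i - 1))) / 2 ^ i)"
    by (intro sum.cong) (auto simp: nth_append)
  with snoc show ?case
    by (simp add: add_divide_distrib)
qed simp

text \<open>Digits are counted from \<open>0\<close>: \<open>digit i\<close> is the coefficient of \<open>2 powr - (i + 1)\<close>.\<close>

definition digit :: "nat \<Rightarrow> real \<Rightarrow> bool" where
  "digit i x \<longleftrightarrow> odd \<lfloor>2 ^ Suc i * x\<rfloor>"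

text \<open>The half-open dyadic interval of order \<open>n\<close> containing \<open>x\<close>. Describing it by floors makes the
nesting of cells and the measurability immediate.\<close>

definition cell :: "nat \<Rightarrow> real \<Rightarrow> real set" where
  "cell n x = {y. \<lfloor>2 ^ n * y\<rfloor> = \<lfloor>2 ^ n * x\<rfloor>}"

lemma floor_pow2_Suc: "\<lfloor>2 ^ Suc n * x\<rfloor> = 2 * \<lfloor>2 ^ n * x\<rfloor> + of_bool (digit n x)"
proof -
  have "\<lfloor>2 ^ n * x\<rfloor> = \<lfloor>2 ^ Suc n * x\<rfloor> div 2"
    using floor_divide_real_eq_div[of 2 "2 ^ Suc n * x"] by simp
  then show ?thesis
    unfolding digit_def by (simp only: of_bool_odd_eq_mod_2 mult_div_mod_eq)
qed

text \<open>The digits \<open>n, \<dots>, n + k - 1\<close> locate the cell of order \<open>n + k\<close> inside the cell of order \<open>n\<close>.\<close>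

lemma floor_pow2_add:
  "\<lfloor>2 ^ (n + k) * x\<rfloor> = 2 ^ k * \<lfloor>2 ^ n * x\<rfloor> + binary_value (map (\<lambda>i. digit i x) [n..<n + k])"
proof (induction k)
  case (Suc k)
  then show ?case
    using floor_pow2_Suc[of "n + k" x] by simp
qed simp

lemma floor_pow2_unit:
  assumes "x \<in> {0..<1}"
  shows "\<lfloor>2 ^ n * x\<rfloor> = binary_value (map (\<lambda>i. digit i x) [0..<n])"
proof -
  have "\<lfloor>x\<rfloor> = 0"
    using assms by (simp add: floor_eq_iff)
  then show ?thesis
    using floor_pow2_add[of 0 n x] by simp
qed

lemma cell_mono:
  assumes "n \<le> k" "y \<in> cell k x"
  shows "y \<in> cell n x"
proof -
  have "\<lfloor>2 ^ n * z\<rfloor> = \<lfloor>2 ^ k * z\<rfloor> div 2 ^ (k - n)" for z :: real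
  proof -
    have "2 ^ k = (2 ^ n * 2 ^ (k - n) :: real)"
      using assms by (simp flip: power_add)
    then show ?thesis
      using floor_divide_real_eq_div[of "2 ^ (k - n)" "2 ^ k * z"] by simp
  qed
  with assms show ?thesis
    by (simp add: cell_def)
qed

lemma cell_subset_unit:
  assumes "x \<in> {0..<1}"
  shows "cell n x \<subseteq> {0..<1}"
proof
  fix y assume "y \<in> cell n x"
  then have "y \<in> cell 0 x"
    by (rule cell_mono[rotated]) simp
  moreover have "\<lfloor>x\<rfloor> = 0"
    using assms by (simp add: floor_eq_iff)
  ultimately have "\<lfloor>y\<rfloor> = 0"
    by (simp add: cell_def)
  then show "y \<in> {0..<1}"
    by (simp add: floor_eq_iff)
qed

lemma cell_eq_digits:
  assumes "x \<in> {0..<1}"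
  shows "cell n x = {y\<in>{0..<1}. map (\<lambda>i. digit i y) [0..<n] = map (\<lambda>i. digit i x) [0..<n]}"
proof (intro equalityI subsetI)
  fix y assume y: "y \<in> cell n x"
  then have "y \<in> {0..<1}"
    using cell_subset_unit[OF assms] by blast
  with y assms show "y \<in> {y\<in>{0..<1}. map (\<lambda>i. digit i y) [0..<n] = map (\<lambda>i. digit i x) [0..<n]}"
    by (auto simp: cell_def floor_pow2_unit simp del: map_eq_conv intro!: binary_value_inj)
next
  fix y assume "y \<in> {y\<in>{0..<1}. map (\<lambda>i. digit i y) [0..<n] = map (\<lambda>i. digit i x) [0..<n]}"
  with assms show "y \<in> cell n x"
    by (simp add: cell_def floor_pow2_unit del: map_eq_conv)
qed

lemma measurable_digit [measurable]: "digit i \<in> measurable borel (count_space UNIV)"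
proof -
  have "digit i = (\<lambda>k. odd k) \<circ> (\<lambda>x. \<lfloor>2 ^ Suc i * x\<rfloor>)"
    by (auto simp: digit_def)
  then show ?thesis
    by simp
qed

lemma dyadic_interval_eq_digits:
  "dyadic_interval (length w) (\<lambda>i. of_bool (w ! (i - 1))) =
    {x\<in>{0..<1}. map (\<lambda>i. digit i x) [0..<length w] = w}"
proof -
  let ?F = "real_of_int (binary_value w)" and ?N = "2 ^ length w :: real"
  have "dyadic_interval (length w) (\<lambda>i. of_bool (w ! (i - 1))) = {?F / ?N..<?F / ?N + 1 / ?N}"
    unfolding dyadic_interval_def sum_binary_digits ..
  also have "\<dots> = {x. \<lfloor>?N * x\<rfloor> = binary_value w}"
    by (auto simp: floor_eq_iff field_simps)
  also have "\<dots> = {x\<in>{0..<1}. map (\<lambda>i. digit i x) [0..<length w] = w}"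
  proof (intro equalityI subsetI)
    fix x assume x: "x \<in> {x. \<lfloor>?N * x\<rfloor> = binary_value w}"
    then have "?F \<le> ?N * x" "?N * x < ?F + 1"
      by (auto simp: floor_eq_iff)
    moreover have "0 \<le> ?F" "?F + 1 \<le> ?N"
      using binary_value_nonneg[of w] binary_value_less[of w]
      by (simp, metis of_int_1 of_int_add of_int_le_iff of_int_numeral of_int_power zless_imp_add1_zle)
    ultimately have "0 \<le> ?N * x" "?N * x < ?N * 1"
      by linarith+
    moreover have "?N > 0"
      by simp
    ultimately have "0 \<le> x" "x < 1"
      by (meson mult_pos_neg not_le, simp only: mult_less_cancel_left_pos)
    then have unit: "x \<in> {0..<1}"
      by simp
    with x show "x \<in> {x\<in>{0..<1}. map (\<lambda>i. digit i x) [0..<length w] = w}"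
      by (auto simp: floor_pow2_unit intro!: binary_value_inj)
  qed (auto simp: floor_pow2_unit)
  finally show ?thesis .
qed

lemma bernoulli_process_digit:
  assumes p: "0 < p" "p < 1" and m: "bernoulli_product p m"
  shows "bernoulli_process m p digit"
proof -
  interpret prob_space m
    using m by (simp add: bernoulli_product_def)
  have space: "space m = {0..<1}" and sets: "sets m = sets (restrict_space borel {0..<1})"
    using m by (auto simp: bernoulli_product_def)
  show ?thesis
  proof unfold_locales
    fix i
    have "digit i \<in> measurable (restrict_space borel {0..<1}) (count_space UNIV)"
      by (intro measurable_restrict_space1) measurable
    then show "digit i \<in> measurable m (count_space UNIV)"
      using measurable_cong_sets[OF sets refl] by blast
  next
    fix w :: "bool list"
    show "prob {x\<in>space m. map (\<lambda>i. digit i x) [0..<length w] = w} = (\<Prod>b\<leftarrow>w. if b then p else 1 - p)"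
    proof (cases "w = []")
      case False
      then have "length w \<ge> 1"
        by (cases w) auto
      moreover have "\<forall>n\<ge>1. \<forall>e. (\<forall>i\<in>{1..n}. e i \<in> {0, 1}) \<longrightarrow> measure m (dyadic_interval n e) =
          p ^ (\<Sum>i=1..n. e i) * (1 - p) ^ (n - (\<Sum>i=1..n. e i))"
        using m by (simp add: bernoulli_product_def)
      ultimately have "measure m (dyadic_interval (length w) (\<lambda>i. of_bool (w ! (i - 1)))) =
          p ^ ones w * (1 - p) ^ (length w - ones w)"
        unfolding ones_eq_sum_nth by (auto simp: of_bool_def)
      then show ?thesis
        unfolding dyadic_interval_eq_digits space prod_coin_weights .
    qed (simp add: prob_space)
  qed (use p in auto)
qed

section \<open>Comparing packing measures with measures\<close>

text \<open>Countable unions are treated through finite subfamilies, since unordered sums of nonnegative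
extended reals are suprema of finite sums as well.\<close>

lemma emeasure_Union_le_finite:
  assumes "countable \<C>" "\<C> \<subseteq> sets M"
    and le: "\<And>F. finite F \<Longrightarrow> F \<subseteq> \<C> \<Longrightarrow> emeasure M (\<Union>F) \<le> B"
  shows "emeasure M (\<Union>\<C>) \<le> B"
proof (cases "\<C> = {}")
  case False
  define X where "X n = (\<Union>i\<le>n. from_nat_into \<C> i)" for n :: nat
  have into: "from_nat_into \<C> i \<in> \<C>" for i
    by (rule from_nat_into[OF False])
  have "\<Union>\<C> = (\<Union>i. from_nat_into \<C> i)"
    by (simp add: range_from_nat_into[OF False assms(1)])
  also have "\<dots> = (\<Union>n. X n)"
    unfolding X_def by blast
  finally have eq: "\<Union>\<C> = (\<Union>n. X n)" .
  have "range X \<subseteq> sets M" "incseq X"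
    using into assms(2) by (auto simp: X_def incseq_def subset_iff intro!: sets.finite_UN)
  then have "emeasure M (\<Union>\<C>) = (SUP n. emeasure M (X n))"
    unfolding eq by (intro SUP_emeasure_incseq[symmetric])
  also have "\<dots> \<le> B"
    using into unfolding X_def by (intro SUP_least le) auto
  finally show ?thesis .
qed (use le[of "{}"] in simp)

lemma packing_sup_mono_set:
  assumes "A \<subseteq> B"
  shows "packing_sup \<Psi> \<eta> A \<le> packing_sup \<Psi> \<eta> B"
  unfolding packing_sup_def
  by (rule SUP_subset_mono) (use assms in \<open>fastforce simp: packings_def\<close>, simp)

lemma packing_premeasure_mono_fun:
  assumes "\<forall>\<^sub>F t in at_right 0. \<Psi> t \<le> \<Psi>' t"
  shows "packing_premeasure \<Psi> A \<le> packing_premeasure \<Psi>' A"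
proof -
  obtain \<delta> where "\<delta> > 0" and \<delta>: "\<And>t. 0 < t \<Longrightarrow> t < \<delta> \<Longrightarrow> \<Psi> t \<le> \<Psi>' t"
    using assms by (auto simp: eventually_at_right_field)
  have "\<forall>\<^sub>F \<eta> in at_right 0. packing_sup \<Psi> \<eta> A \<le> packing_sup \<Psi>' \<eta> A"
    unfolding eventually_at_right_field
  proof (intro exI conjI allI impI)
    fix \<eta> :: real assume "0 < \<eta>" "\<eta> < \<delta>"
    then show "packing_sup \<Psi> \<eta> A \<le> packing_sup \<Psi>' \<eta> A"
      unfolding packing_sup_def
    proof (intro SUP_mono)
      fix \<B> assume "\<B> \<in> packings \<eta> A"
      then have "0 < diameter B \<and> diameter B < \<delta>" if "B \<in> \<B>" for B
        using that \<open>\<eta> < \<delta>\<close> unfolding packings_def by fastforce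
      with \<open>\<B> \<in> packings \<eta> A\<close> show "\<exists>\<B>'\<in>packings \<eta> A.
          (\<Sum>\<^sub>\<infinity>B\<in>\<B>. ennreal (\<Psi> (diameter B))) \<le> (\<Sum>\<^sub>\<infinity>B\<in>\<B>'. ennreal (\<Psi>' (diameter B)))"
        by (intro bexI[of _ \<B>] infsum_mono ennreal_leI \<delta>) (auto intro: nonneg_summable_on_complete)
    qed
  qed fact
  then show ?thesis
    by (rule tendsto_le[OF _ tendsto_packing_premeasure tendsto_packing_premeasure, rotated]) simp
qed

lemma packing_measure_mono_fun:
  assumes "\<forall>\<^sub>F t in at_right 0. \<Psi> t \<le> \<Psi>' t"
  shows "packing_measure \<Psi> A \<le> packing_measure \<Psi>' A"
  unfolding packing_measure_def
  by (intro INF_mono' suminf_le summableI packing_premeasure_mono_fun assms)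

text \<open>The balls of a packing are disjoint, so the sum of their gauges is at most \<open>\<delta>\<close> times the total mass.
The density hypothesis has to hold uniformly on \<open>A\<close>.\<close>

lemma packing_premeasure_eq_0:
  fixes m :: "real measure"
  assumes "prob_space m" and balls: "\<And>x r. cball x r \<inter> space m \<in> sets m"
    and dens: "\<And>\<delta>. \<delta> > 0 \<Longrightarrow> \<exists>\<eta>>0. \<forall>x\<in>A. \<forall>r>0. 2 * r \<le> \<eta> \<longrightarrow>
      \<Psi> (2 * r) \<le> \<delta> * measure m (cball x r \<inter> space m)"
  shows "packing_premeasure \<Psi> A = 0"
proof -
  interpret prob_space m by fact
  have le: "packing_premeasure \<Psi> A \<le> ennreal \<delta>" if "\<delta> > 0" for \<delta>
  proof -
    obtain \<eta> where "\<eta> > 0" and \<eta>: "\<And>x r. x \<in> A \<Longrightarrow> r > 0 \<Longrightarrow> 2 * r \<le> \<eta> \<Longrightarrow>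
        \<Psi> (2 * r) \<le> \<delta> * measure m (cball x r \<inter> space m)"
      using dens[OF \<open>\<delta> > 0\<close>] by auto
    have "packing_premeasure \<Psi> A \<le> packing_sup \<Psi> \<eta> A"
      using \<open>\<eta> > 0\<close> unfolding packing_premeasure_eq_INF by (intro INF_lower) simp
    also have "\<dots> \<le> ennreal \<delta>"
      unfolding packing_sup_def
    proof (rule SUP_least)
      fix \<B> assume \<B>: "\<B> \<in> packings \<eta> A"
      have ball: "\<Psi> (diameter B) \<le> \<delta> * measure m (B \<inter> space m) \<and> B \<inter> space m \<in> sets m" if "B \<in> \<B>" for B
      proof -
        have "(\<exists>x\<in>A. \<exists>r. B = cball x r) \<and> 0 < diameter B \<and> diameter B \<le> \<eta>"
          using \<B> that by (simp add: packings_def)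
        then obtain x r where B: "x \<in> A" "B = cball x r" "0 < diameter B" "diameter B \<le> \<eta>"
          by blast
        then have "r > 0" "diameter B = 2 * r"
          by (auto simp: diameter_cball split: if_splits)
        with B \<eta>[of x r] balls show ?thesis
          by auto
      qed
      have "(\<Sum>\<^sub>\<infinity>B\<in>\<B>. ennreal (\<Psi> (diameter B))) =
          (SUP F\<in>{F. finite F \<and> F \<subseteq> \<B>}. \<Sum>B\<in>F. ennreal (\<Psi> (diameter B)))"
        by (rule nonneg_infsum_complete) simp
      also have "\<dots> \<le> ennreal \<delta>"
      proof (rule SUP_least)
        fix F assume F: "F \<in> {F. finite F \<and> F \<subseteq> \<B>}"
        have "(\<Sum>B\<in>F. ennreal (\<Psi> (diameter B))) \<le> (\<Sum>B\<in>F. ennreal (\<delta> * measure m (B \<inter> space m)))"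
          using F ball by (intro sum_mono ennreal_leI) auto
        also have "\<dots> = ennreal (\<Sum>B\<in>F. \<delta> * measure m (B \<inter> space m))"
          using \<open>\<delta> > 0\<close> by (intro sum_ennreal) simp
        also have "(\<Sum>B\<in>F. \<delta> * measure m (B \<inter> space m)) = \<delta> * measure m (\<Union>B\<in>F. B \<inter> space m)"
          unfolding sum_distrib_left[symmetric]
        proof (subst finite_measure_finite_Union)
          show "disjoint_family_on (\<lambda>B. B \<inter> space m) F"
            using F \<B> unfolding disjoint_family_on_def packings_def disjoint_def by blast
        qed (use F ball in auto)
        also have "ennreal \<dots> \<le> ennreal \<delta>"
          using \<open>\<delta> > 0\<close> prob_le_1 by (intro ennreal_leI mult_left_le) auto
        finally show "(\<Sum>B\<in>F. ennreal (\<Psi> (diameter B))) \<le> ennreal \<delta>" .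
      qed
      finally show "(\<Sum>\<^sub>\<infinity>B\<in>\<B>. ennreal (\<Psi> (diameter B))) \<le> ennreal \<delta>" .
    qed
    finally show ?thesis .
  qed
  have "packing_premeasure \<Psi> A \<le> 0"
  proof (rule ennreal_le_epsilon)
    fix e :: real assume "0 < e"
    from le[OF this] show "packing_premeasure \<Psi> A \<le> 0 + ennreal e"
      by simp
  qed
  then show ?thesis
    by simp
qed

lemma packing_measure_eq_0:
  assumes "E \<subseteq> (\<Union>i. F i)" "\<And>i :: nat. packing_premeasure \<Psi> (F i) = 0"
  shows "packing_measure \<Psi> E = 0"
proof -
  have "packing_measure \<Psi> E \<le> (\<Sum>i. packing_premeasure \<Psi> (F i))"
    unfolding packing_measure_def using assms(1) by (intro INF_lower) simp
  then show ?thesis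
    using assms(2) by simp
qed

text \<open>A covering argument that needs no covering theorem, because two cells are either nested or disjoint.
For each point of \<open>A\<close> take the cell of least order that is good for some point of \<open>A\<close> in it. These
cells are the maximal good ones, hence pairwise disjoint, and they cover \<open>A\<close>. A good cell contains
a ball of controlled size centred in \<open>A\<close>; one such ball from each of the disjoint cells forms a packing.\<close>

lemma cover_by_cells:
  fixes m :: "real measure"
  assumes cells: "\<And>n x. x \<in> A \<Longrightarrow> cell n x \<in> sets m"
    and dens: "\<And>x. x \<in> A \<Longrightarrow> \<exists>n \<rho>. 0 < \<rho> \<and> 2 * \<rho> \<le> \<eta> \<and> cball x \<rho> \<subseteq> cell n x \<and>
      emeasure m (cell n x) \<le> \<delta> * ennreal (\<Psi> (2 * \<rho>))"
  obtains U where "U \<in> sets m" "A \<subseteq> U" "emeasure m U \<le> \<delta> * packing_sup \<Psi> \<eta> A"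
proof -
  define good where "good n C \<longleftrightarrow> (\<exists>x\<in>A. \<exists>\<rho>. C = cell n x \<and> 0 < \<rho> \<and> 2 * \<rho> \<le> \<eta> \<and>
      cball x \<rho> \<subseteq> C \<and> emeasure m C \<le> \<delta> * ennreal (\<Psi> (2 * \<rho>)))" for n C
  define lev where "lev x = (LEAST n. good n (cell n x))" for x
  define \<C> where "\<C> = (\<lambda>x. cell (lev x) x) ` A"
  have good: "good (lev x) (cell (lev x) x)" if "x \<in> A" for x
  proof -
    have "\<exists>n. good n (cell n x)"
      unfolding good_def using dens[OF that] that by blast
    then show ?thesis
      unfolding lev_def by (rule LeastI_ex)
  qed
  \<comment> \<open>If two chosen cells meet, the larger one is also good for the point of the smaller one, whose
    least order is therefore not larger.\<close>
  have eq: "cell (lev x) x = cell (lev y) y"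
    if "x \<in> A" "y \<in> A" "z \<in> cell (lev x) x" "z \<in> cell (lev y) y" "lev x \<le> lev y" for x y z
  proof -
    have "z \<in> cell (lev x) y"
      using that cell_mono by blast
    with that have xy: "cell (lev x) x = cell (lev x) y"
      by (auto simp: cell_def)
    with good[OF \<open>x \<in> A\<close>] have "lev y \<le> lev x"
      unfolding lev_def[of y] by (intro Least_le) simp
    with that xy show ?thesis by simp
  qed
  have disj: "disjoint \<C>"
  proof (rule disjointI)
    fix C D assume "C \<in> \<C>" "D \<in> \<C>" "C \<noteq> D"
    then obtain x y where xy: "x \<in> A" "y \<in> A" "C = cell (lev x) x" "D = cell (lev y) y"
      by (auto simp: \<C>_def)
    show "C \<inter> D = {}"
    proof (rule ccontr)
      assume "C \<inter> D \<noteq> {}"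
      then obtain z where "z \<in> cell (lev x) x" "z \<in> cell (lev y) y"
        using xy by auto
      with eq[of x y z] eq[of y x z] xy \<open>C \<noteq> D\<close> show False
        by (cases "lev x \<le> lev y") auto
    qed
  qed
  have "\<C> \<subseteq> (\<lambda>(n, k). {y. \<lfloor>2 ^ n * y\<rfloor> = k}) ` (UNIV :: (nat \<times> int) set)"
    by (auto simp: \<C>_def cell_def)
  then have count: "countable \<C>"
    by (rule countable_subset) simp
  have sets: "\<C> \<subseteq> sets m"
    using cells by (auto simp: \<C>_def)
  have "\<forall>C\<in>\<C>. \<exists>B. (\<exists>x\<in>A. \<exists>r. B = cball x r) \<and> 0 < diameter B \<and> diameter B \<le> \<eta> \<and> B \<subseteq> C \<and> B \<noteq> {} \<and>
      emeasure m C \<le> \<delta> * ennreal (\<Psi> (diameter B))"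
  proof
    fix C assume "C \<in> \<C>"
    then obtain x \<rho> where "x \<in> A" "0 < \<rho>" "2 * \<rho> \<le> \<eta>" "cball x \<rho> \<subseteq> C"
      "emeasure m C \<le> \<delta> * ennreal (\<Psi> (2 * \<rho>))"
      using good unfolding \<C>_def good_def by blast
    then show "\<exists>B. (\<exists>x\<in>A. \<exists>r. B = cball x r) \<and> 0 < diameter B \<and> diameter B \<le> \<eta> \<and> B \<subseteq> C \<and> B \<noteq> {} \<and>
        emeasure m C \<le> \<delta> * ennreal (\<Psi> (diameter B))"
      by (intro exI[of _ "cball x \<rho>"]) (auto simp: diameter_cball)
  qed
  then obtain b where b: "\<And>C. C \<in> \<C> \<Longrightarrow> (\<exists>x\<in>A. \<exists>r. b C = cball x r) \<and> 0 < diameter (b C) \<and>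
      diameter (b C) \<le> \<eta> \<and> b C \<subseteq> C \<and> b C \<noteq> {} \<and> emeasure m C \<le> \<delta> * ennreal (\<Psi> (diameter (b C)))"
    by metis
  have b_disj: "b C \<inter> b D = {}" if "C \<in> \<C>" "D \<in> \<C>" "C \<noteq> D" for C D
  proof -
    have "C \<inter> D = {}"
      using disj that by (auto dest: disjointD)
    moreover have "b C \<subseteq> C" "b D \<subseteq> D"
      using b that by simp_all
    ultimately show ?thesis
      by blast
  qed
  have inj: "inj_on b \<C>"
  proof (rule inj_onI, rule ccontr)
    fix C D assume "C \<in> \<C>" "D \<in> \<C>" "b C = b D" "C \<noteq> D"
    then have "b D = {}"
      using b_disj[of C D] by simp
    with b[OF \<open>D \<in> \<C>\<close>] show False
      by simp
  qed
  have "b ` \<C> \<in> packings \<eta> A"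
    unfolding packings_def mem_Collect_eq
  proof (intro conjI ballI)
    show "disjoint (b ` \<C>)"
    proof (rule disjointI)
      fix B B' assume "B \<in> b ` \<C>" "B' \<in> b ` \<C>" "B \<noteq> B'"
      then show "B \<inter> B' = {}"
        using b_disj by fastforce
    qed
  qed (use b count in blast)+
  then have "(\<Sum>\<^sub>\<infinity>B\<in>b ` \<C>. ennreal (\<Psi> (diameter B))) \<le> packing_sup \<Psi> \<eta> A"
    unfolding packing_sup_def by (rule SUP_upper)
  then have sup: "(\<Sum>\<^sub>\<infinity>C\<in>\<C>. ennreal (\<Psi> (diameter (b C)))) \<le> packing_sup \<Psi> \<eta> A"
    by (subst (asm) infsum_reindex[OF inj]) (simp add: o_def)
  show thesis
  proof (rule that)
    show "\<Union>\<C> \<in> sets m"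
      using count sets by (intro sets.countable_Union)
    show "A \<subseteq> \<Union>\<C>"
      by (auto simp: \<C>_def cell_def)
    show "emeasure m (\<Union>\<C>) \<le> \<delta> * packing_sup \<Psi> \<eta> A"
    proof (rule emeasure_Union_le_finite[OF count sets])
      fix F assume F: "finite F" "F \<subseteq> \<C>"
      have "emeasure m (\<Union>F) \<le> (\<Sum>C\<in>F. emeasure m C)"
        using emeasure_subadditive_finite[OF F(1), of "\<lambda>C. C" m] F sets by auto
      also have "\<dots> \<le> (\<Sum>C\<in>F. \<delta> * ennreal (\<Psi> (diameter (b C))))"
        using F b by (intro sum_mono) blast
      also have "\<dots> = \<delta> * (\<Sum>\<^sub>\<infinity>C\<in>F. ennreal (\<Psi> (diameter (b C))))"
        using F by (simp add: sum_distrib_left)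
      also have "\<dots> \<le> \<delta> * (\<Sum>\<^sub>\<infinity>C\<in>\<C>. ennreal (\<Psi> (diameter (b C))))"
        using F by (intro mult_left_mono infsum_mono_neutral) (auto intro: nonneg_summable_on_complete)
      also have "\<dots> \<le> \<delta> * packing_sup \<Psi> \<eta> A"
        using sup by (intro mult_left_mono) auto
      finally show "emeasure m (\<Union>F) \<le> \<delta> * packing_sup \<Psi> \<eta> A" .
    qed
  qed
qed

text \<open>A set of finite packing measure is covered by countably many pieces of finite pre-measure. Each
piece, up to a null set, has for every \<open>\<delta>\<close> a measurable cover of measure at most \<open>\<delta>\<close> times a finite
number that does not depend on \<open>\<delta>\<close>. The pieces themselves may be nonmeasurable, which
is why measurable covers appear.\<close>

lemma finite_packing_measure_imp_null:
  fixes m :: "real measure"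
  assumes space: "space m \<subseteq> {0..<1}" and cells: "\<And>n x. x \<in> space m \<Longrightarrow> cell n x \<in> sets m"
    and dens: "AE x in m. \<forall>\<delta>>0. \<forall>\<eta>>0. \<exists>n \<rho>. 0 < \<rho> \<and> 2 * \<rho> \<le> \<eta> \<and> cball x \<rho> \<subseteq> cell n x \<and>
      emeasure m (cell n x) \<le> ennreal \<delta> * ennreal (\<Psi> (2 * \<rho>))"
    and E: "E \<in> sets m" and fin: "packing_measure \<Psi> E < \<infinity>"
  shows "emeasure m E = 0"
proof -
  define G where "G = {x\<in>space m. \<forall>\<delta>>0. \<forall>\<eta>>0. \<exists>n \<rho>. 0 < \<rho> \<and> 2 * \<rho> \<le> \<eta> \<and> cball x \<rho> \<subseteq> cell n x \<and>
      emeasure m (cell n x) \<le> ennreal \<delta> * ennreal (\<Psi> (2 * \<rho>))}"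
  obtain F :: "nat \<Rightarrow> real set" where F: "E \<subseteq> (\<Union>i. F i)" "(\<Sum>i. packing_premeasure \<Psi> (F i)) < \<infinity>"
    using fin unfolding packing_measure_def INF_less_iff by blast
  have "\<exists>Z\<in>null_sets m. F i \<inter> G \<subseteq> Z" for i
  proof -
    have "packing_premeasure \<Psi> (F i) < \<infinity>"
      using F(2) ennreal_suminf_lessD by blast
    then obtain \<eta> where \<eta>: "\<eta> > 0" "packing_sup \<Psi> \<eta> (F i) < \<infinity>"
      unfolding packing_premeasure_eq_INF by (auto simp: INF_less_iff)
    define B where "B = packing_sup \<Psi> \<eta> (F i)"
    have "\<exists>U. U \<in> sets m \<and> F i \<inter> G \<subseteq> U \<and> emeasure m U \<le> ennreal (1 / Suc j) * B" for j
    proof (rule cover_by_cells[of "F i \<inter> G" m \<eta> "ennreal (1 / Suc j)" \<Psi>])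
      fix x assume x: "x \<in> F i \<inter> G"
      then show "cell n x \<in> sets m" for n
        using cells by (auto simp: G_def)
      show "\<exists>n \<rho>. 0 < \<rho> \<and> 2 * \<rho> \<le> \<eta> \<and> cball x \<rho> \<subseteq> cell n x \<and>
          emeasure m (cell n x) \<le> ennreal (1 / Suc j) * ennreal (\<Psi> (2 * \<rho>))"
        using x \<eta>(1) by (simp add: G_def del: of_nat_Suc)
    next
      fix U assume "U \<in> sets m" "F i \<inter> G \<subseteq> U"
        "emeasure m U \<le> ennreal (1 / Suc j) * packing_sup \<Psi> \<eta> (F i \<inter> G)"
      moreover have "ennreal (1 / Suc j) * packing_sup \<Psi> \<eta> (F i \<inter> G) \<le> ennreal (1 / Suc j) * B"
        unfolding B_def by (intro mult_left_mono packing_sup_mono_set) auto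
      ultimately show ?thesis
        by (meson order_trans)
    qed
    then obtain U where U: "\<And>j. U j \<in> sets m" "\<And>j. F i \<inter> G \<subseteq> U j"
      "\<And>j. emeasure m (U j) \<le> ennreal (1 / Suc j) * B"
      by metis
    obtain c where c: "B = ennreal c" "c \<ge> 0"
      using \<eta>(2) by (cases B) (auto simp: B_def)
    have "emeasure m (\<Inter>j. U j) \<le> ennreal (c / Suc j)" for j
    proof -
      have "emeasure m (\<Inter>j. U j) \<le> emeasure m (U j)"
        using U(1) by (intro emeasure_mono) auto
      also have "\<dots> \<le> ennreal (1 / Suc j) * ennreal c"
        using U(3)[of j] unfolding c(1) .
      also have "\<dots> = ennreal (c / Suc j)"
        using c(2) by (subst ennreal_mult[symmetric]) auto
      finally show ?thesis .
    qed
    moreover have "(\<lambda>j. ennreal (c / Suc j)) \<longlonglongrightarrow> ennreal 0"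
      by (intro tendsto_ennrealI LIMSEQ_Suc lim_const_over_n)
    ultimately have "emeasure m (\<Inter>j. U j) \<le> ennreal 0"
      by (intro LIMSEQ_le_const) auto
    then have "(\<Inter>j. U j) \<in> null_sets m"
      using U(1) by (auto intro!: null_setsI)
    with U(2) show ?thesis
      by (intro bexI[of _ "\<Inter>j. U j"]) auto
  qed
  then obtain Z where Z: "\<And>i. Z i \<in> null_sets m" "\<And>i. F i \<inter> G \<subseteq> Z i"
    by metis
  have "AE x in m. \<forall>i. x \<notin> Z i"
    unfolding AE_all_countable by (intro allI AE_not_in Z(1))
  with dens AE_space have "AE x in m. x \<notin> E"
  proof eventually_elim
    case (elim x)
    then have "x \<in> G"
      by (auto simp: G_def)
    with elim Z(2) F(1) show ?case
      by blast
  qed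
  then show ?thesis
    using E by (subst (asm) AE_iff_null_sets[symmetric]) auto
qed

section \<open>Gauges with an iterated logarithm\<close>

text \<open>The functions that define the packing measures, with \<open>\<tau>\<close> in place of \<open>\<sigma> - \<epsilon>\<close> and \<open>\<sigma> + \<epsilon>\<close>.\<close>

definition lil_gauge :: "real \<Rightarrow> real \<Rightarrow> real \<Rightarrow> real" where
  "lil_gauge d \<tau> t = t powr d * Theta t powr (- \<tau>)"

lemma lil_gauge_0: "lil_gauge d 0 = (\<lambda>t. t powr d)"
proof
  fix t
  have "Theta t > 0"
    by (simp add: Theta_def)
  then show "lil_gauge d 0 t = t powr d"
    by (simp add: lil_gauge_def)
qed

lemma lil_gauge_powr: "lil_gauge d \<tau> (2 powr (- u)) = 2 powr (- u * d - \<tau> * lil_scale u)"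
proof -
  have "log 2 (1 / 2 powr (- u)) = u"
    by (simp add: powr_minus field_simps)
  then have "Theta (2 powr (- u)) = 2 powr lil_scale u"
    by (simp add: Theta_def lil_scale_def)
  then show ?thesis
    by (simp add: lil_gauge_def powr_powr powr_add[symmetric] algebra_simps)
qed

lemma eventually_at_right_powr2:
  assumes "\<forall>\<^sub>F u in at_top. P (2 powr (- u))"
  shows "\<forall>\<^sub>F t in at_right (0::real). P t"
proof -
  have "filterlim (\<lambda>t::real. - log 2 t) at_top (at_right 0)"
    by real_asymp
  from eventually_compose_filterlim[OF assms this]
  have "\<forall>\<^sub>F t in at_right (0::real). P (2 powr (- (- log 2 t)))" .
  then show ?thesis
    using eventually_at_right_less by eventually_elim simp
qed

lemma lil_scale_nonneg:
  assumes "3 \<le> u"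
  shows "0 \<le> lil_scale u"
  using ln_ge_1_of_ge_3[OF assms] assms by (simp add: lil_scale_def)

text \<open>The gauge of a diameter \<open>2 powr (- u)\<close> against the eventual lower bound for the measure of the cell of an order
\<open>n\<close> that exceeds \<open>u\<close> by at most \<open>2\<close>: the difference between \<open>\<tau>\<close> and \<open>\<tau>'\<close> outweighs every constant factor.\<close>

lemma lil_gauge_le_cell_bound:
  assumes "0 \<le> d" "0 < \<tau>'" "\<tau>' < \<tau>" "0 < \<delta>"
  shows "\<forall>\<^sub>F u in at_top. \<forall>n::nat. 3 \<le> n \<and> n \<le> u + 2 \<longrightarrow>
    lil_gauge d \<tau> (2 powr (- u)) \<le> \<delta> * 2 powr (- (n * d) - \<tau>' * lil_scale n)"
proof -
  have "filterlim (\<lambda>u. \<tau> * lil_scale u - \<tau>' * lil_scale (u + 2)) at_top at_top"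
    unfolding lil_scale_def using assms by real_asymp
  then have "\<forall>\<^sub>F u in at_top. 2 * d - log 2 \<delta> \<le> \<tau> * lil_scale u - \<tau>' * lil_scale (u + 2)"
    by (simp add: filterlim_at_top)
  then show ?thesis
  proof eventually_elim
    case (elim u)
    note u = elim
    show ?case
    proof (intro allI impI)
      fix n :: nat assume n: "3 \<le> real n \<and> real n \<le> u + 2"
      have "n * d \<le> (u + 2) * d"
        using n assms by (intro mult_right_mono) auto
      moreover have "\<tau>' * lil_scale n \<le> \<tau>' * lil_scale (u + 2)"
        using n assms by (intro mult_left_mono lil_scale_mono) auto
      ultimately have "- u * d - \<tau> * lil_scale u \<le> log 2 \<delta> + (- (n * d) - \<tau>' * lil_scale n)"
        using u by (simp add: distrib_right)
      then have "2 powr (- u * d - \<tau> * lil_scale u) \<le> 2 powr (log 2 \<delta> + (- (n * d) - \<tau>' * lil_scale n))"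
        by simp
      then show "lil_gauge d \<tau> (2 powr (- u)) \<le> \<delta> * 2 powr (- (n * d) - \<tau>' * lil_scale n)"
        using \<open>0 < \<delta>\<close> by (simp add: lil_gauge_powr powr_add del: powr_le_cancel_iff)
    qed
  qed
qed

text \<open>The upper bound for the measure of a cell of order \<open>n\<close> against the gauge of a ball that is smaller
than the cell by a factor polynomial in \<open>n\<close>: this factor costs \<open>O(ln n)\<close> in the exponent, and the
difference between \<open>\<tau>'\<close> and \<open>\<tau>\<close> gains the order of \<open>sqrt (n ln (ln n))\<close>.\<close>

lemma cell_bound_le_lil_gauge:
  assumes "0 < \<tau>'" "\<tau> < \<tau>'" "0 < C" "0 < \<delta>"
  shows "\<forall>\<^sub>F n::nat in sequentially. 2 powr (- (n * d) - \<tau>' * lil_scale n) \<le>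
    \<delta> * lil_gauge d \<tau> (2 * 2 powr (- (n + C * ln n)))"
proof -
  \<comment> \<open>Replacing \<open>\<tau>\<close> by a larger positive number below \<open>\<tau>'\<close> covers negative \<open>\<tau>\<close>.\<close>
  define \<tau>\<^sub>0 where "\<tau>\<^sub>0 = (max \<tau> 0 + \<tau>') / 2"
  have \<tau>\<^sub>0: "0 < \<tau>\<^sub>0" "\<tau> < \<tau>\<^sub>0" "\<tau>\<^sub>0 < \<tau>'"
    using assms by (auto simp: \<tau>\<^sub>0_def)
  have "filterlim (\<lambda>n::nat. \<tau>' * lil_scale n - \<tau>\<^sub>0 * lil_scale (n + C * ln n - 1) - d * (C * ln n))
      at_top sequentially"
    unfolding lil_scale_def using \<tau>\<^sub>0 assms by real_asymp
  then have "\<forall>\<^sub>F n::nat in sequentially. - d - log 2 \<delta> \<le>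
      \<tau>' * lil_scale n - \<tau>\<^sub>0 * lil_scale (n + C * ln n - 1) - d * (C * ln n)"
    by (simp add: filterlim_at_top)
  moreover have "\<forall>\<^sub>F n::nat in sequentially. 3 \<le> n + C * ln n - 1"
    using assms by real_asymp
  ultimately show ?thesis
  proof eventually_elim
    case (elim n)
    let ?u = "n + C * ln n - 1"
    have "\<tau> * lil_scale ?u \<le> \<tau>\<^sub>0 * lil_scale ?u"
      using \<tau>\<^sub>0 elim(2) by (intro mult_right_mono lil_scale_nonneg) auto
    with elim(1) have "- (n * d) - \<tau>' * lil_scale n \<le> log 2 \<delta> + (- ?u * d - \<tau> * lil_scale ?u)"
      by (simp add: algebra_simps)
    then have "2 powr (- (n * d) - \<tau>' * lil_scale n) \<le> 2 powr (log 2 \<delta> + (- ?u * d - \<tau> * lil_scale ?u))"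
      by simp
    also have "\<dots> = \<delta> * lil_gauge d \<tau> (2 powr (- ?u))"
      using \<open>0 < \<delta>\<close> unfolding lil_gauge_powr by (simp add: powr_add)
    also have "2 powr (- ?u) = 2 * 2 powr (- (n + C * ln n))"
      by (simp add: powr_diff powr_add powr_minus field_simps)
    finally show ?case .
  qed
qed

lemma powr_le_lil_gauge:
  assumes "d < s" "0 < \<tau>"
  shows "\<forall>\<^sub>F t in at_right 0. t powr s \<le> lil_gauge d \<tau> t"
proof (rule eventually_at_right_powr2)
  have "filterlim (\<lambda>u. (s - d) * u - \<tau> * lil_scale u) at_top at_top"
    unfolding lil_scale_def using assms by real_asymp
  then have "\<forall>\<^sub>F u in at_top. 0 \<le> (s - d) * u - \<tau> * lil_scale u"
    unfolding filterlim_at_top by blast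
  then show "\<forall>\<^sub>F u in at_top. (2 powr - u) powr s \<le> lil_gauge d \<tau> (2 powr - u)"
    by eventually_elim (simp add: lil_gauge_powr powr_powr algebra_simps)
qed

section \<open>Packing measures and the Bernoulli product\<close>

lemma mixed_word:
  assumes "length w = k" "w \<noteq> replicate k True" "w \<noteq> replicate k False"
  shows "True \<in> set w \<and> False \<in> set w"
  using assms by (metis (full_types) replicate_eqI)

text \<open>If the \<open>k\<close> digits after position \<open>n\<close> are not all equal, then \<open>x\<close> lies neither in the first nor in the
last subcell of order \<open>n + k\<close> of its cell, so its distance to the complement is at least the length of a subcell.\<close>

lemma cball_subset_cell:
  assumes "map (\<lambda>i. digit i x) [n..<n + k] \<noteq> replicate k True"
    "map (\<lambda>i. digit i x) [n..<n + k] \<noteq> replicate k False"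
  shows "cball x (1 / 2 ^ (n + k)) \<subseteq> cell n x"
proof
  let ?w = "map (\<lambda>i. digit i x) [n..<n + k]" and ?j = "\<lfloor>2 ^ n * x\<rfloor>"
  let ?N = "2 ^ (n + k) :: real"
  have w: "True \<in> set ?w" "False \<in> set ?w"
    using mixed_word[of ?w k] assms by auto
  have lo: "1 \<le> binary_value ?w"
    using w(1) by (rule binary_value_pos)
  have hi: "binary_value ?w + 2 \<le> 2 ^ k"
    using binary_value_not_max[OF w(2)] by simp
  have floor: "\<lfloor>?N * x\<rfloor> = 2 ^ k * ?j + binary_value ?w"
    by (rule floor_pow2_add)
  fix y assume "y \<in> cball x (1 / ?N)"
  then have "\<bar>y - x\<bar> \<le> 1 / ?N"
    by (simp add: dist_real_def abs_minus_commute)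
  then have "?N * \<bar>y - x\<bar> \<le> 1"
    by (simp add: pos_le_divide_eq mult.commute)
  then have "\<bar>?N * (y - x)\<bar> \<le> 1"
    by (simp add: abs_mult)
  then have y: "?N * x - 1 \<le> ?N * y" "?N * y \<le> ?N * x + 1"
    unfolding right_diff_distrib abs_le_iff by linarith+
  have "2 ^ k * ?j + 1 \<le> \<lfloor>?N * x\<rfloor>" "\<lfloor>?N * x\<rfloor> + 2 \<le> 2 ^ k * (?j + 1)"
    using floor lo hi by (simp_all add: distrib_left)
  then have "real_of_int (2 ^ k * ?j + 1) \<le> \<lfloor>?N * x\<rfloor>" "real_of_int (\<lfloor>?N * x\<rfloor> + 2) \<le> real_of_int (2 ^ k * (?j + 1))"
    by (simp_all only: of_int_le_iff)
  then have "2 ^ k * real_of_int ?j \<le> ?N * y" "?N * y < 2 ^ k * (real_of_int ?j + 1)"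
    using y of_int_floor_le[of "?N * x"] floor_less_iff[of "?N * x" "\<lfloor>?N * x\<rfloor> + 1"]
    by (simp_all) linarith+
  then have "real_of_int ?j \<le> 2 ^ n * y" "2 ^ n * y < real_of_int ?j + 1"
    by (simp_all add: power_add mult.commute[of "2 ^ n"] mult.assoc)
  then show "y \<in> cell n x"
    by (simp add: cell_def floor_eq_iff)
qed

locale bernoulli_measure =
  fixes p d \<sigma> :: real and m :: "real measure"
  assumes p01: "0 < p" "p < 1"
    and m: "bernoulli_product p m"
    and d_eq: "d = - p * log 2 p - (1 - p) * log 2 (1 - p)"
    and \<sigma>_pos: "\<sigma> > 0"
    and \<sigma>_sq: "\<sigma>\<^sup>2 = p * (1 - p) * (log 2 (p / (1 - p)))\<^sup>2"
begin

sublocale bernoulli_process m p digit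
  using p01 m by (rule bernoulli_process_digit)

abbreviation L :: real where "L \<equiv> log 2 (p / (1 - p))"

lemma space_m: "space m = {0..<1}"
  and sets_m: "sets m = sets (restrict_space borel {0..<1})"
  using m by (auto simp: bernoulli_product_def)

lemma sets_m_iff: "A \<in> sets m \<longleftrightarrow> A \<subseteq> {0..<1} \<and> A \<in> sets borel"
  unfolding sets_m by (subst sets_restrict_space_iff) auto

lemma cell_in_sets:
  assumes "x \<in> space m"
  shows "cell n x \<in> sets m"
proof -
  have "cell n x \<in> sets borel"
    unfolding cell_def by measurable
  then show ?thesis
    using assms cell_subset_unit[of x n] unfolding sets_m_iff space_m by blast
qed

lemma d_nonneg: "0 \<le> d"
proof -
  have "log 2 p \<le> 0" "log 2 (1 - p) \<le> 0"
    using p01 by auto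
  then show ?thesis
    unfolding d_eq using p01 mult_nonneg_nonpos[of p "log 2 p"] mult_nonneg_nonpos[of "1 - p" "log 2 (1 - p)"]
    by simp
qed

lemma \<sigma>_eq: "\<sigma> = sqrt (p * (1 - p)) * \<bar>L\<bar>"
proof -
  have "\<sigma> = sqrt (\<sigma>\<^sup>2)"
    using \<sigma>_pos by simp
  also have "\<dots> = sqrt (p * (1 - p)) * \<bar>L\<bar>"
    unfolding \<sigma>_sq real_sqrt_mult[of "p * (1 - p)"] by simp
  finally show ?thesis .
qed

text \<open>The entropy \<open>d\<close> is the mean of the information per digit, and the centred number of ones measures
the fluctuation around it.\<close>

lemma measure_cell:
  assumes "x \<in> space m"
  shows "measure m (cell n x) = 2 powr (- (n * d) + (wins n x - n * p) * L)"
proof -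
  let ?w = "map (\<lambda>i. digit i x) [0..<n]"
  have le: "ones ?w \<le> n"
    using count_le_length[of ?w True] by simp
  have "cell n x = {y\<in>space m. map (\<lambda>i. digit i y) [0..<length ?w] = ?w}"
    using assms by (simp add: space_m cell_eq_digits)
  then have "measure m (cell n x) = p ^ ones ?w * (1 - p) ^ (n - ones ?w)"
    using prob_cylinder[of ?w] by (simp only: prod_coin_weights length_map length_upt diff_zero)
  also have "\<dots> = p powr ones ?w * (1 - p) powr (real n - ones ?w)"
    unfolding of_nat_diff[OF le, symmetric] using p01 by (simp add: powr_realpow del: of_nat_diff)
  also have "\<dots> = 2 powr (log 2 p * ones ?w) * 2 powr (log 2 (1 - p) * (real n - ones ?w))"
    using p01 by (simp only: powr_powr[symmetric]) simp
  also have "\<dots> = 2 powr (log 2 p * ones ?w + log 2 (1 - p) * (real n - ones ?w))"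
    by (simp only: powr_add)
  also have "log 2 p * ones ?w + log 2 (1 - p) * (real n - ones ?w) =
      - (n * d) + (wins n x - n * p) * L"
    using p01 by (simp add: d_eq log_divide algebra_simps)
  finally show ?thesis .
qed

text \<open>The measure of a cell is small when the more probable digit is rarer than expected; the sign
of \<open>L\<close> decides which digit that is, hence which tail of the number of ones matters.\<close>

lemma AE_measure_cell_ge:
  assumes "\<sigma> < \<tau>"
  shows "AE x in m. \<forall>\<^sub>F n in sequentially. 2 powr (- (n * d) - \<tau> * lil_scale n) \<le> measure m (cell n x)"
proof -
  define \<epsilon> where "\<epsilon> = \<tau> / \<sigma> - 1"
  have \<epsilon>: "\<epsilon> > 0"
    using assms \<sigma>_pos by (simp add: \<epsilon>_def)
  have \<tau>: "\<tau> = (1 + \<epsilon>) * sqrt (p * (1 - p)) * \<bar>L\<bar>"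
    unfolding mult.assoc \<sigma>_eq[symmetric] using \<sigma>_pos by (simp add: \<epsilon>_def)
  show ?thesis
  proof (cases "L \<ge> 0")
    case True
    show ?thesis
      using lil_upper_complement[OF \<epsilon>] AE_space
    proof eventually_elim
      case (elim x)
      from elim(1) show ?case
      proof eventually_elim
        case (elim n)
        from mult_right_mono[OF elim True] show ?case
          using \<open>x \<in> space m\<close> True by (simp add: measure_cell \<tau> algebra_simps)
      qed
    qed
  next
    case False
    then have "0 \<le> - L" by simp
    show ?thesis
      using lil_upper[OF \<epsilon>] AE_space
    proof eventually_elim
      case (elim x)
      from elim(1) show ?case
      proof eventually_elim
        case (elim n)
        from mult_right_mono[OF elim \<open>0 \<le> - L\<close>] show ?case
          using \<open>x \<in> space m\<close> False by (simp add: measure_cell \<tau> algebra_simps)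
      qed
    qed
  qed
qed

lemma AE_measure_cell_le:
  assumes "0 < \<tau>" "\<tau> < \<sigma>"
  shows "AE x in m. \<exists>\<^sub>F n in sequentially. measure m (cell n x) \<le> 2 powr (- (n * d) - \<tau> * lil_scale n)"
proof -
  define \<theta> where "\<theta> = \<tau> / \<sigma>"
  have \<theta>: "0 < \<theta>" "\<theta> < 1"
    using assms \<sigma>_pos by (simp_all add: \<theta>_def)
  have \<tau>: "\<tau> = \<theta> * sqrt (p * (1 - p)) * \<bar>L\<bar>"
    unfolding mult.assoc \<sigma>_eq[symmetric] using \<sigma>_pos by (simp add: \<theta>_def)
  show ?thesis
  proof (cases "L \<ge> 0")
    case True
    show ?thesis
      using lil_lower_complement[OF \<theta>] AE_space
    proof eventually_elim
      case (elim x)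
      from elim(1) show ?case
      proof (rule frequently_elim1)
        fix n assume "\<theta> * sqrt (p * (1 - p)) * lil_scale n \<le> n * p - wins n x"
        from mult_right_mono[OF this True]
        show "measure m (cell n x) \<le> 2 powr (- (n * d) - \<tau> * lil_scale n)"
          using \<open>x \<in> space m\<close> True by (simp add: measure_cell \<tau> algebra_simps)
      qed
    qed
  next
    case False
    then have "0 \<le> - L" by simp
    show ?thesis
      using lil_lower[OF \<theta>] AE_space
    proof eventually_elim
      case (elim x)
      from elim(1) show ?case
      proof (rule frequently_elim1)
        fix n assume "\<theta> * sqrt (p * (1 - p)) * lil_scale n \<le> wins n x - n * p"
        from mult_right_mono[OF this \<open>0 \<le> - L\<close>]
        show "measure m (cell n x) \<le> 2 powr (- (n * d) - \<tau> * lil_scale n)"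
          using \<open>x \<in> space m\<close> False by (simp add: measure_cell \<tau> algebra_simps)
      qed
    qed
  qed
qed

text \<open>The probability that the \<open>k\<close> digits after position \<open>n\<close> are all equal is at most \<open>2 r ^ k\<close>, where \<open>r\<close>
is the larger of \<open>p\<close> and \<open>1 - p\<close>. For \<open>k\<close> a suitable multiple of \<open>ln n\<close> this is \<open>O(1 / n\<^sup>2)\<close>, so
Borel--Cantelli excludes such runs for large \<open>n\<close>.\<close>

lemma AE_cball_subset_cell:
  obtains C where "C > 0"
    "AE x in m. \<forall>\<^sub>F n::nat in sequentially. cball x (2 powr (- (n + C * ln n))) \<subseteq> cell n x"
proof -
  define r where "r = max p (1 - p)"
  have r: "0 < r" "r < 1" "p \<le> r" "1 - p \<le> r"
    using p01 by (auto simp: r_def)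
  have "ln r < 0"
    using r by simp
  \<comment> \<open>so that \<open>r powr (c * ln n) = n powr - 2\<close>\<close>
  define c where "c = - 2 / ln r"
  have "c > 0"
    using \<open>ln r < 0\<close> by (simp add: c_def divide_neg_neg)
  define k where "k n = nat \<lceil>c * ln n\<rceil>" for n :: nat
  define const where "const k w \<longleftrightarrow> w = replicate k True \<or> w = replicate k False" for k and w :: "bool list"
  let ?E = "\<lambda>n. {x\<in>space m. const (k n) (map (\<lambda>i. digit i x) [n..<n + k n])}"
  have prob_E: "prob (?E n) \<le> 2 * r ^ k n" for n
  proof -
    have "prob (?E n) = measure_pmf.prob (coin_words (k n) p) {w. const (k n) w}"
      by (rule prob_block)
    also have "{w. const (k n) w} = {replicate (k n) True} \<union> {replicate (k n) False}"
      by (auto simp: const_def)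
    also have "measure_pmf.prob (coin_words (k n) p) \<dots> \<le>
        measure_pmf.prob (coin_words (k n) p) {replicate (k n) True} +
        measure_pmf.prob (coin_words (k n) p) {replicate (k n) False}"
      by (intro measure_Un_le) auto
    also have "\<dots> = p ^ k n + (1 - p) ^ k n"
      using p01 by (simp add: measure_pmf_single pmf_coin_words prod_list_replicate del: replicate_pmf.simps)
    also have "\<dots> \<le> r ^ k n + r ^ k n"
      using p01 r by (intro add_mono power_mono) auto
    finally show ?thesis by simp
  qed
  have "summable (\<lambda>n. prob (?E n))"
  proof (rule summable_comparison_test_ev)
    show "\<forall>\<^sub>F n in sequentially. norm (prob (?E n)) \<le> 2 * real n powr - 2"
      using eventually_gt_at_top[of 0]
    proof eventually_elim
      case (elim n)
      have "r ^ k n = r powr k n"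
        using r by (simp add: powr_realpow)
      also have "\<dots> \<le> r powr (c * ln n)"
        using r unfolding k_def by (intro powr_mono' of_nat_ceiling) auto
      also have "\<dots> = real n powr - 2"
        using r elim \<open>ln r < 0\<close> by (simp add: powr_def c_def)
      finally show ?case
        using prob_E[of n] by simp
    qed
    show "summable (\<lambda>n. 2 * real n powr - 2)"
      by (intro summable_mult) (simp add: summable_real_powr_iff)
  qed
  then have "AE x in m. \<forall>\<^sub>F n in sequentially. x \<in> space m - ?E n"
    by (intro borel_cantelli_AE1) (auto simp: less_top[symmetric])
  then have "AE x in m. \<forall>\<^sub>F n::nat in sequentially. cball x (2 powr (- (n + (c + 1) * ln n))) \<subseteq> cell n x"
  proof eventually_elim
    case (elim x)
    have "\<forall>\<^sub>F n::nat in sequentially. 1 \<le> ln n"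
      by real_asymp
    with elim show ?case
    proof eventually_elim
      case (elim n)
      then have sub: "cball x (1 / 2 ^ (n + k n)) \<subseteq> cell n x"
        by (intro cball_subset_cell) (auto simp: const_def)
      have "0 \<le> c * ln n"
        using elim \<open>c > 0\<close> by simp
      then have "k n \<le> c * ln n + 1"
        unfolding k_def by linarith
      then have "k n \<le> (c + 1) * ln n"
        using elim by (simp add: distrib_right)
      then have "2 powr (- (n + (c + 1) * ln n)) \<le> 2 powr - real (n + k n)"
        by simp
      also have "\<dots> = 1 / 2 ^ (n + k n)"
        by (simp only: powr_minus_divide powr_realpow zero_less_numeral)
      finally show ?case
        using sub by (meson order_trans subset_cball)
    qed
  qed
  with \<open>c > 0\<close> show ?thesis
    by (intro that[of "c + 1"]) auto
qed

text \<open>With \<open>\<tau>'\<close> strictly between \<open>\<tau>\<close> and \<open>\<sigma>\<close> (and positive), infinitely many cells around almost every point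
have measure at most the bound for \<open>\<tau>'\<close>, and the room between \<open>\<tau>\<close> and \<open>\<tau>'\<close> pays both for the smaller ball and
for the arbitrary constant \<open>\<delta>\<close>.\<close>

theorem null_of_finite_packing_measure:
  assumes "\<tau> < \<sigma>" "E \<in> sets m" "packing_measure (lil_gauge d \<tau>) E < \<infinity>"
  shows "emeasure m E = 0"
proof (rule finite_packing_measure_imp_null[OF _ _ _ assms(2,3)])
  show "space m \<subseteq> {0..<1}"
    by (simp add: space_m)
  show "cell n x \<in> sets m" if "x \<in> space m" for n x
    using that by (rule cell_in_sets)
  obtain C where C: "C > 0"
    "AE x in m. \<forall>\<^sub>F n::nat in sequentially. cball x (2 powr (- (n + C * ln n))) \<subseteq> cell n x"
    by (rule AE_cball_subset_cell)
  define \<tau>' where "\<tau>' = (max \<tau> 0 + \<sigma>) / 2"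
  have \<tau>': "0 < \<tau>'" "\<tau> < \<tau>'" "\<tau>' < \<sigma>"
    using assms \<sigma>_pos by (auto simp: \<tau>'_def)
  show "AE x in m. \<forall>\<delta>>0. \<forall>\<eta>>0. \<exists>n \<rho>. 0 < \<rho> \<and> 2 * \<rho> \<le> \<eta> \<and> cball x \<rho> \<subseteq> cell n x \<and>
      emeasure m (cell n x) \<le> ennreal \<delta> * ennreal (lil_gauge d \<tau> (2 * \<rho>))"
    using C(2) AE_measure_cell_le[OF \<tau>'(1,3)]
  proof eventually_elim
    case (elim x)
    show ?case
    proof (intro allI impI)
      fix \<delta> \<eta> :: real assume "0 < \<delta>" "0 < \<eta>"
      have "(\<lambda>n::nat. 2 * 2 powr (- (n + C * ln n))) \<longlonglongrightarrow> 0"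
        using C(1) by real_asymp
      then have "\<forall>\<^sub>F n::nat in sequentially. 2 * 2 powr (- (n + C * ln n)) < \<eta>"
        using \<open>0 < \<eta>\<close> by (rule order_tendstoD)
      with elim(1) cell_bound_le_lil_gauge[OF \<tau>'(1,2) C(1) \<open>0 < \<delta>\<close>, of d]
      have "\<forall>\<^sub>F n::nat in sequentially. cball x (2 powr (- (n + C * ln n))) \<subseteq> cell n x \<and>
          2 * 2 powr (- (n + C * ln n)) \<le> \<eta> \<and>
          2 powr (- (n * d) - \<tau>' * lil_scale n) \<le> \<delta> * lil_gauge d \<tau> (2 * 2 powr (- (n + C * ln n)))"
        by eventually_elim auto
      from frequently_eventually_conj[OF elim(2) this] obtain n where n:
        "measure m (cell n x) \<le> 2 powr (- (n * d) - \<tau>' * lil_scale n)"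
        "cball x (2 powr (- (n + C * ln n))) \<subseteq> cell n x"
        "2 * 2 powr (- (n + C * ln n)) \<le> \<eta>"
        "2 powr (- (n * d) - \<tau>' * lil_scale n) \<le> \<delta> * lil_gauge d \<tau> (2 * 2 powr (- (n + C * ln n)))"
        by (auto dest!: frequently_ex)
      then have "emeasure m (cell n x) \<le> ennreal (\<delta> * lil_gauge d \<tau> (2 * 2 powr (- (n + C * ln n))))"
        unfolding emeasure_eq_measure by (intro ennreal_leI) simp
      also have "\<dots> = ennreal \<delta> * ennreal (lil_gauge d \<tau> (2 * 2 powr (- (n + C * ln n))))"
        using \<open>0 < \<delta>\<close> by (intro ennreal_mult) (auto simp: lil_gauge_def)
      finally show "\<exists>n \<rho>. 0 < \<rho> \<and> 2 * \<rho> \<le> \<eta> \<and> cball x \<rho> \<subseteq> cell n x \<and>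
          emeasure m (cell n x) \<le> ennreal \<delta> * ennreal (lil_gauge d \<tau> (2 * \<rho>))"
        using n by (intro exI[of _ n] exI[of _ "2 powr (- (n + C * ln n))"]) auto
    qed
  qed
qed

lemma measure_cball_ge_cell:
  assumes "x \<in> space m" "1 / 2 ^ n \<le> r"
  shows "measure m (cell n x) \<le> measure m (cball x r \<inter> space m)"
proof (rule finite_measure_mono)
  show "cell n x \<subseteq> cball x r \<inter> space m"
  proof
    fix y assume y: "y \<in> cell n x"
    then have "\<bar>2 ^ n * x - 2 ^ n * y\<bar> < 1"
      unfolding cell_def by (simp add: floor_eq_iff) linarith
    then have "\<bar>2 ^ n * (x - y)\<bar> < 1"
      by (simp only: right_diff_distrib)
    then have "\<bar>x - y\<bar> < 1 / 2 ^ n"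
      by (simp add: abs_mult pos_less_divide_eq mult.commute)
    then show "y \<in> cball x r \<inter> space m"
      using y assms cell_subset_unit[of x n] by (auto simp: dist_real_def space_m)
  qed
  show "cball x r \<inter> space m \<in> sets m"
    by (simp add: sets_m_iff space_m)
qed

text \<open>The set consists of the points at which the lower bound for the measure of cells holds eventually. On the part \<open>F N\<close>
where it holds from \<open>N\<close> on it is uniform, so that this part has pre-measure zero.\<close>

theorem ex_full_packing_null_set:
  assumes "\<sigma> < \<tau>"
  obtains E where "E \<in> sets m" "emeasure m E = 1" "packing_measure (lil_gauge d \<tau>) E = 0"
proof -
  define \<tau>' where "\<tau>' = (\<sigma> + \<tau>) / 2"
  have \<tau>': "0 < \<tau>'" "\<sigma> < \<tau>'" "\<tau>' < \<tau>"
    using assms \<sigma>_pos by (auto simp: \<tau>'_def)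
  let ?good = "\<lambda>n x. 2 powr (- (n * d) - \<tau>' * lil_scale n) \<le> 2 powr (- (n * d) + (wins n x - n * p) * L)"
  define F where "F N = {x\<in>space m. \<forall>n\<ge>N. ?good n x}" for N :: nat
  define E where "E = (\<Union>N. F N)"
  have [measurable]: "Measurable.pred m (\<lambda>x. ?good n x)" for n
    by measurable
  have E: "E \<in> sets m"
    unfolding E_def F_def by measurable
  have "AE x in m. x \<in> E"
    using AE_measure_cell_ge[OF \<tau>'(2)] AE_space
  proof eventually_elim
    case (elim x)
    then show ?case
      by (auto simp: E_def F_def measure_cell eventually_sequentially)
  qed
  with E have full: "emeasure m E = 1"
    by (rule emeasure_eq_1_AE)
  have "packing_premeasure (lil_gauge d \<tau>) (F N) = 0" for N
  proof (rule packing_premeasure_eq_0)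
    show "prob_space m"
      by (rule prob_space_axioms)
    show "cball x r \<inter> space m \<in> sets m" for x r
      by (simp add: sets_m_iff space_m)
    fix \<delta> :: real assume "0 < \<delta>"
    have "\<forall>\<^sub>F u::real in at_top. max 3 (real N) \<le> u"
      by (rule eventually_ge_at_top)
    with lil_gauge_le_cell_bound[OF d_nonneg \<tau>'(1,3) \<open>0 < \<delta>\<close>]
    have "\<forall>\<^sub>F u::real in at_top. max 3 (real N) \<le> u \<and> (\<forall>n::nat. 3 \<le> real n \<and> real n \<le> u + 2 \<longrightarrow>
        lil_gauge d \<tau> (2 powr (- u)) \<le> \<delta> * 2 powr (- (n * d) - \<tau>' * lil_scale n))"
      by eventually_elim auto
    then obtain u\<^sub>0 where u\<^sub>0: "\<And>(u::real) n. u\<^sub>0 \<le> u \<Longrightarrow> max 3 (real N) \<le> u \<and> (3 \<le> real n \<and> real n \<le> u + 2 \<longrightarrow>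
        lil_gauge d \<tau> (2 powr (- u)) \<le> \<delta> * 2 powr (- (n * d) - \<tau>' * lil_scale n))"
      unfolding eventually_at_top_linorder by blast
    show "\<exists>\<eta>>0. \<forall>x\<in>F N. \<forall>r>0. 2 * r \<le> \<eta> \<longrightarrow>
        lil_gauge d \<tau> (2 * r) \<le> \<delta> * measure m (cball x r \<inter> space m)"
    proof (intro exI[of _ "2 powr (- u\<^sub>0)"] conjI ballI allI impI)
      fix x r assume x: "x \<in> F N" and r: "0 < r" "2 * r \<le> 2 powr (- u\<^sub>0)"
      define u where "u = - log 2 (2 * r)"
      have r_eq: "2 powr (- u) = 2 * r"
        using r by (simp add: u_def)
      with r have "2 powr (- u) \<le> 2 powr (- u\<^sub>0)"
        by simp
      then have "u\<^sub>0 \<le> u"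
        by simp
      note u = u\<^sub>0[OF this]
      \<comment> \<open>the least order for which the cell of \<open>x\<close> is certainly contained in the ball\<close>
      define n where "n = nat \<lceil>u + 1\<rceil>"
      have n: "u + 1 \<le> n" "n \<le> u + 2"
        using u[of 0] unfolding n_def by linarith+
      have "2 powr - real n \<le> 2 powr (- (u + 1))"
        using n by simp
      also have "\<dots> = r"
        using r_eq by (simp add: powr_diff)
      finally have "1 / 2 ^ n \<le> r"
        by (simp only: powr_minus_divide powr_realpow zero_less_numeral)
      have "x \<in> space m" "N \<le> n"
        using x n u[of 0] by (auto simp: F_def)
      then have good: "2 powr (- (n * d) - \<tau>' * lil_scale n) \<le> measure m (cell n x)"
        using x by (simp add: F_def measure_cell)
      have "lil_gauge d \<tau> (2 * r) \<le> \<delta> * 2 powr (- (n * d) - \<tau>' * lil_scale n)"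
        using u[of n] n unfolding r_eq by auto
      also have "\<dots> \<le> \<delta> * measure m (cball x r \<inter> space m)"
        using good measure_cball_ge_cell[OF \<open>x \<in> space m\<close> \<open>1 / 2 ^ n \<le> r\<close>] \<open>0 < \<delta>\<close>
        by (intro mult_left_mono) auto
      finally show "lil_gauge d \<tau> (2 * r) \<le> \<delta> * measure m (cball x r \<inter> space m)" .
    qed simp
  qed
  then have "packing_measure (lil_gauge d \<tau>) E = 0"
    by (intro packing_measure_eq_0[of E F]) (simp_all add: E_def)
  with E full show ?thesis by (rule that)
qed

lemma null_of_finite_packing_measure_powr:
  assumes "E \<in> sets m" "packing_measure (\<lambda>t. t powr d) E < \<infinity>"
  shows "emeasure m E = 0"
  using null_of_finite_packing_measure[OF \<sigma>_pos] assms by (simp add: lil_gauge_0)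

text \<open>For \<open>s < d\<close> the \<open>s\<close>-dimensional packing measure dominates the \<open>d\<close>-dimensional one, which is infinite
on every set of positive measure.\<close>

lemma packing_dim_ge:
  assumes "E \<in> sets m" "emeasure m E > 0"
  shows "ereal d \<le> packing_dim E"
  unfolding packing_dim_def
proof (rule Inf_greatest)
  fix x assume "x \<in> {ereal s | s. 0 \<le> s \<and> packing_measure (\<lambda>t. t powr s) E = 0}"
  then obtain s where s: "x = ereal s" "packing_measure (\<lambda>t. t powr s) E = 0"
    by auto
  have "d \<le> s"
  proof (rule ccontr)
    assume "\<not> d \<le> s"
    have "\<forall>\<^sub>F t::real in at_right 0. t \<in> {0<..<1}"
      by (rule eventually_at_right_real) simp
    then have "\<forall>\<^sub>F t in at_right 0. t powr d \<le> t powr s"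
      by eventually_elim (use \<open>\<not> d \<le> s\<close> in \<open>auto intro!: powr_mono'\<close>)
    then have "packing_measure (\<lambda>t. t powr d) E \<le> packing_measure (\<lambda>t. t powr s) E"
      by (rule packing_measure_mono_fun)
    with s have "packing_measure (\<lambda>t. t powr d) E < \<infinity>"
      by simp
    with assms null_of_finite_packing_measure_powr show False
      by simp
  qed
  with s show "ereal d \<le> x"
    by simp
qed

lemma packing_dim_le:
  assumes "packing_measure (lil_gauge d \<tau>) E = 0" "\<tau> > 0"
  shows "packing_dim E \<le> ereal d"
proof (rule ereal_le_epsilon2)
  fix e :: real assume "0 < e"
  have "packing_measure (\<lambda>t. t powr (d + e)) E \<le> packing_measure (lil_gauge d \<tau>) E"
    using \<open>0 < e\<close> assms(2) by (intro packing_measure_mono_fun powr_le_lil_gauge) auto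
  with assms(1) have "packing_measure (\<lambda>t. t powr (d + e)) E = 0"
    by simp
  then have "packing_dim E \<le> ereal (d + e)"
    unfolding packing_dim_def using d_nonneg \<open>0 < e\<close> by (intro Inf_lower) auto
  then show "packing_dim E \<le> ereal d + ereal e"
    by simp
qed

lemma lower_packing_dim_eq: "lower_packing_dim m = ereal d"
  and upper_packing_dim_eq: "upper_packing_dim m = ereal d"
proof -
  have "\<sigma> < \<sigma> + 1"
    by simp
  then obtain E where E: "E \<in> sets m" "emeasure m E = 1" "packing_measure (lil_gauge d (\<sigma> + 1)) E = 0"
    by (rule ex_full_packing_null_set)
  have "packing_dim E \<le> ereal d"
    using E(3) \<sigma>_pos by (intro packing_dim_le[of "\<sigma> + 1"]) auto
  moreover have "upper_packing_dim m \<le> packing_dim E"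
    unfolding upper_packing_dim_def using E by (intro Inf_lower) auto
  moreover have "lower_packing_dim m \<le> packing_dim E"
    unfolding lower_packing_dim_def using E by (intro Inf_lower) auto
  moreover have "ereal d \<le> lower_packing_dim m"
    unfolding lower_packing_dim_def by (intro Inf_greatest) (auto intro: packing_dim_ge)
  moreover have "ereal d \<le> upper_packing_dim m"
    unfolding upper_packing_dim_def by (intro Inf_greatest) (auto intro: packing_dim_ge)
  ultimately show "lower_packing_dim m = ereal d" "upper_packing_dim m = ereal d"
    by auto
qed

end

theorem proposition2p4:
  fixes p d \<sigma> :: real and m :: "real measure"
  assumes "0 < p" and "p < 1" and "p \<noteq> 1 / 2"
    and "bernoulli_product p m"
    and "d = - p * log 2 p - (1 - p) * log 2 (1 - p)"
    and "\<sigma> > 0" and "\<sigma>\<^sup>2 = p * (1 - p) * (log 2 (p / (1 - p)))\<^sup>2"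
  shows
    "(\<forall>\<epsilon>>0.
        abs_continuous_wrt m (packing_measure (\<lambda>t. t powr d * Theta t powr (- (\<sigma> - \<epsilon>)))) \<and>
        singular_wrt m (packing_measure (\<lambda>t. t powr d * Theta t powr (- (\<sigma> + \<epsilon>))))) \<and>
     lower_packing_dim m = ereal d \<and> upper_packing_dim m = ereal d \<and>
     abs_continuous_wrt m (packing_measure (\<lambda>t. t powr d)) \<and>
     (\<forall>E\<in>sets m. packing_measure (\<lambda>t. t powr d) E < \<infinity> \<longrightarrow> emeasure m E = 0)"
proof -
  interpret bernoulli_measure p d \<sigma> m
    by unfold_locales (use assms in auto)
  have null: "emeasure m E = 0"
    if "\<tau> < \<sigma>" "E \<in> sets m" "packing_measure (\<lambda>t. t powr d * Theta t powr (- \<tau>)) E < \<infinity>" for \<tau> E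
    using null_of_finite_packing_measure[of \<tau> E] that by (simp add: lil_gauge_def[abs_def])
  have "abs_continuous_wrt m (packing_measure (\<lambda>t. t powr d * Theta t powr (- (\<sigma> - \<epsilon>))))" if "\<epsilon> > 0" for \<epsilon>
    unfolding abs_continuous_wrt_def using null[of "\<sigma> - \<epsilon>"] that by simp
  moreover have "singular_wrt m (packing_measure (\<lambda>t. t powr d * Theta t powr (- (\<sigma> + \<epsilon>))))" if "\<epsilon> > 0" for \<epsilon>
  proof -
    have "\<sigma> < \<sigma> + \<epsilon>"
      using that by simp
    then obtain E where "E \<in> sets m" "emeasure m E = 1" "packing_measure (lil_gauge d (\<sigma> + \<epsilon>)) E = 0"
      by (rule ex_full_packing_null_set)
    then show ?thesis
      unfolding singular_wrt_def lil_gauge_def[abs_def] by blast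
  qed
  moreover have "abs_continuous_wrt m (packing_measure (\<lambda>t. t powr d))"
    unfolding abs_continuous_wrt_def using null_of_finite_packing_measure_powr by simp
  ultimately show ?thesis
    using lower_packing_dim_eq upper_packing_dim_eq null_of_finite_packing_measure_powr by blast
qed

end
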